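(* Fix $K\ge 2$ and a set $B$ of ordered pairs $(r,t)$, $r\ne t$, such that the $K$-user network with bottleneck-link set $B$ is in a minimal bottleneck state. Let $A_1,\dots,A_L$ be fixed-strength channel states, each of which corresponds to the bottleneck set $B$ (i.e. $(A_\ell)_{rt}=\sqrt{\mathrm{SNR}}$ for all $(r,t)\in B$ and all $\ell$; the other cross strengths are arbitrary and may differ across $\ell$). Then the parallel interference channel formed by $A_1,\dots,A_L$ is separable: its sum capacity equals $\sum_{\ell=1}^L C_\Sigma(A_\ell)$.
   Context: Model: fix an integer $K\ge 2$, $\mathcal K=\{1,\dots,K\}$, and a constant $\mathrm{SNR}>0$. At each channel use $n\in\mathbb N$, receiver $r\in\mathcal K$ observes $Y^{[r]}(n)=\sum_{t\in\mathcal K}H^{[rt]}(n)e^{j\phi^{[rt]}(n)}X^{[t]}(n)+Z^{[r]}(n)$, where $X^{[t]}(n)\in\mathbb C$ has power constraint $E|X^{[t]}|^2\le 1$, the noises are zero-mean unit-variance circularly symmetric complex Gaussian, i.i.d. over $n$; the phases $\phi^{[rt]}(n)$ are i.i.d. uniform on $[0,2\pi)$ and independent of the strengths; $H^{[kk]}(n)=\sqrt{\mathrm{SNR}}$; $H^{[rt]}(n)=\sqrt{\mathrm{INR}^{[rt]}(n)}$ for $r\ne t$, with $(\mathrm{INR}^{[rt]}(n))_{r\neq t}$ i.i.d. over $n$ with arbitrary joint distribution. $H^{[rt]}$ is the link from transmitter $t$ to receiver $r$. Full channel knowledge at all nodes; independent messages $W_k$ from transmitter $k$ to receiver $k$; sum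 capacity in the standard Shannon sense; logs base 2. Definitions: a cross-channel $H^{[rt]}$ is a bottleneck link if $\mathrm{INR}^{[rt]}(n)=\mathrm{SNR}$ for all $n$. For a set $B$ of ordered pairs $(r,t)$, $r\ne t$, the network in which exactly the links in $B$ are constrained to be bottleneck links is in a bottleneck state if its sum capacity takes the same value for every choice of the distribution of the strengths of the cross-links not in $B$. A bottleneck state is minimal if no bottleneck state (for the same $K$) has strictly fewer bottleneck links. A fixed-strength channel state is a $K\times K$ matrix $A$ of nonnegative entries with $A_{kk}=\sqrt{\mathrm{SNR}}$; its channel is the model with $H^{[rt]}(n)=A_{rt}$ for all $n$ (phases still i.i.d. uniform), with sum capacity $C_\Sigma(A)$. The parallel interference channel formed by states $A_1,\dots,A_L$: at each channel use every transmitter $t$ sends one symbol $X^{[t]}_\ell(n)$ on each subchannel $\ell$, with power constraint $E|X^{[t]}_\ell|^2\le1$ per subchannel, and each receiver observes all $L$ subchannel outputs, subchannel $\ell$ behaving as the channel of $A_\ell$ with phases and noise independent across subchannels; coding may be joint across subchannels. The parallel channel is separable if its sum capacity equals $\sum_\ell C_\Sigma(A_\ell)$. *)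

theory Defs
  imports "HOL-Probability.Probability"
begin

text \<open>Users/transmitters/receivers are 0..<K, subchannels 0..<L, channel uses 0..<N.
  At each channel use a state s (drawn i.i.d. from the probability measure S) is realised;
  on subchannel l, receiver r observes
  Y_{r,l}(n) = sum_t gain s l r t * X_{t,l}(n) + Z_{r,l}(n)
  with Z i.i.d. circularly symmetric complex Gaussian of unit variance.
  Full channel knowledge: encoders and decoders know the whole state sequence of the block.\<close>

definition cgauss :: "complex measure" where
  "cgauss = density lborel (\<lambda>z. ennreal (exp (- (cmod z)\<^sup>2) / pi))"

definition state_seq :: "'s measure \<Rightarrow> nat \<Rightarrow> (nat \<Rightarrow> 's) measure" where
  "state_seq S N = PiM {..<N} (\<lambda>_. S)"

definition noise_seq :: "nat \<Rightarrow> nat \<Rightarrow> nat \<Rightarrow> (nat \<times> nat \<times> nat \<Rightarrow> complex) measure" where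
  "noise_seq K L N = PiM ({..<N} \<times> {..<L} \<times> {..<K}) (\<lambda>_. cgauss)"

definition joint_space :: "nat \<Rightarrow> nat \<Rightarrow> 's measure \<Rightarrow> nat \<Rightarrow>
    ((nat \<Rightarrow> 's) \<times> (nat \<times> nat \<times> nat \<Rightarrow> complex)) measure" where
  "joint_space K L S N = state_seq S N \<Otimes>\<^sub>M noise_seq K L N"

definition msgs :: "nat \<Rightarrow> (nat \<Rightarrow> nat) \<Rightarrow> (nat \<Rightarrow> nat) set" where
  "msgs K M = PiE {..<K} (\<lambda>k. {..<M k})"

definition chan_out :: "nat \<Rightarrow> nat \<Rightarrow> nat \<Rightarrow> ('s \<Rightarrow> nat \<Rightarrow> nat \<Rightarrow> nat \<Rightarrow> complex)
    \<Rightarrow> (nat \<Rightarrow> nat \<Rightarrow> (nat \<Rightarrow> 's) \<Rightarrow> nat \<Rightarrow> nat \<Rightarrow> complex)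
    \<Rightarrow> nat \<Rightarrow> (nat \<Rightarrow> nat) \<Rightarrow> (nat \<Rightarrow> 's) \<Rightarrow> (nat \<times> nat \<times> nat \<Rightarrow> complex)
    \<Rightarrow> nat \<Rightarrow> nat \<Rightarrow> complex" where
  "chan_out K L N gain enc r w s z =
     (\<lambda>n l. if n < N \<and> l < L
            then (\<Sum>t<K. gain (s n) l r t * enc t (w t) s n l) + z (n, l, r)
            else 0)"

definition err_event :: "nat \<Rightarrow> nat \<Rightarrow> 's measure \<Rightarrow> nat \<Rightarrow> ('s \<Rightarrow> nat \<Rightarrow> nat \<Rightarrow> nat \<Rightarrow> complex)
    \<Rightarrow> (nat \<Rightarrow> nat \<Rightarrow> (nat \<Rightarrow> 's) \<Rightarrow> nat \<Rightarrow> nat \<Rightarrow> complex)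
    \<Rightarrow> (nat \<Rightarrow> (nat \<Rightarrow> nat \<Rightarrow> complex) \<Rightarrow> (nat \<Rightarrow> 's) \<Rightarrow> nat)
    \<Rightarrow> (nat \<Rightarrow> nat) \<Rightarrow> ((nat \<Rightarrow> 's) \<times> (nat \<times> nat \<times> nat \<Rightarrow> complex)) set" where
  "err_event K L S N gain enc dec w =
     {\<omega> \<in> space (joint_space K L S N).
        \<exists>r<K. dec r (chan_out K L N gain enc r w (fst \<omega>) (snd \<omega>)) (fst \<omega>) \<noteq> w r}"

definition err_prob :: "nat \<Rightarrow> nat \<Rightarrow> 's measure \<Rightarrow> nat \<Rightarrow> ('s \<Rightarrow> nat \<Rightarrow> nat \<Rightarrow> nat \<Rightarrow> complex)
    \<Rightarrow> (nat \<Rightarrow> nat) \<Rightarrow> (nat \<Rightarrow> nat \<Rightarrow> (nat \<Rightarrow> 's) \<Rightarrow> nat \<Rightarrow> nat \<Rightarrow> complex)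
    \<Rightarrow> (nat \<Rightarrow> (nat \<Rightarrow> nat \<Rightarrow> complex) \<Rightarrow> (nat \<Rightarrow> 's) \<Rightarrow> nat) \<Rightarrow> real" where
  "err_prob K L S N gain M enc dec =
     (\<Sum>w\<in>msgs K M. measure (joint_space K L S N) (err_event K L S N gain enc dec w))
       / real (card (msgs K M))"

text \<open>A valid code of blocklength N: measurable encoders, power constraint
  E|X_{k,l}|^2 \<le> 1 per transmitter and subchannel (expectation over the uniform message,
  the states and averaged over the block), and measurable error events.\<close>
definition valid_code :: "nat \<Rightarrow> nat \<Rightarrow> 's measure \<Rightarrow> nat \<Rightarrow> ('s \<Rightarrow> nat \<Rightarrow> nat \<Rightarrow> nat \<Rightarrow> complex)
    \<Rightarrow> (nat \<Rightarrow> nat) \<Rightarrow> (nat \<Rightarrow> nat \<Rightarrow> (nat \<Rightarrow> 's) \<Rightarrow> nat \<Rightarrow> nat \<Rightarrow> complex)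
    \<Rightarrow> (nat \<Rightarrow> (nat \<Rightarrow> nat \<Rightarrow> complex) \<Rightarrow> (nat \<Rightarrow> 's) \<Rightarrow> nat) \<Rightarrow> bool" where
  "valid_code K L S N gain M enc dec \<longleftrightarrow>
     0 < N \<and> (\<forall>k<K. 0 < M k) \<and>
     (\<forall>k<K. \<forall>m<M k. \<forall>n<N. \<forall>l<L.
        (\<lambda>s. enc k m s n l) \<in> borel_measurable (state_seq S N) \<and>
        integrable (state_seq S N) (\<lambda>s. (cmod (enc k m s n l))\<^sup>2)) \<and>
     (\<forall>k<K. \<forall>l<L.
        (\<Sum>n<N. \<Sum>m<M k. \<integral>s. (cmod (enc k m s n l))\<^sup>2 \<partial>state_seq S N)
          \<le> real N * real (M k)) \<and>
     (\<forall>w\<in>msgs K M. err_event K L S N gain enc dec w \<in> sets (joint_space K L S N))"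

definition achievable :: "nat \<Rightarrow> nat \<Rightarrow> 's measure \<Rightarrow> ('s \<Rightarrow> nat \<Rightarrow> nat \<Rightarrow> nat \<Rightarrow> complex)
    \<Rightarrow> (nat \<Rightarrow> real) \<Rightarrow> bool" where
  "achievable K L S gain R \<longleftrightarrow>
     (\<forall>k<K. 0 \<le> R k) \<and>
     (\<forall>\<epsilon>>0. \<exists>N0. \<forall>N\<ge>N0. \<exists>M enc dec.
        valid_code K L S N gain M enc dec \<and>
        (\<forall>k<K. 2 powr (real N * R k) \<le> real (M k)) \<and>
        err_prob K L S N gain M enc dec \<le> \<epsilon>)"

definition sum_capacity :: "nat \<Rightarrow> nat \<Rightarrow> 's measure \<Rightarrow> ('s \<Rightarrow> nat \<Rightarrow> nat \<Rightarrow> nat \<Rightarrow> complex) \<Rightarrow> real" where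
  "sum_capacity K L S gain = Sup {(\<Sum>k<K. R k) | R. achievable K L S gain R}"

definition phase_meas :: "nat \<Rightarrow> (nat \<times> nat \<Rightarrow> real) measure" where
  "phase_meas K = PiM ({..<K} \<times> {..<K}) (\<lambda>_. uniform_measure lborel {0..<2*pi})"

definition offdiag :: "nat \<Rightarrow> (nat \<times> nat) set" where
  "offdiag K = {(r, t). r < K \<and> t < K \<and> r \<noteq> t}"

definition admissible_INR :: "nat \<Rightarrow> real \<Rightarrow> (nat \<times> nat) set \<Rightarrow> (nat \<times> nat \<Rightarrow> real) measure \<Rightarrow> bool" where
  "admissible_INR K SNR B D \<longleftrightarrow>
     prob_space D \<and> sets D = sets (PiM (offdiag K) (\<lambda>_. borel :: real measure)) \<and>
     (AE i in D. \<forall>p\<in>offdiag K. 0 \<le> i p) \<and>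
     (AE i in D. \<forall>p\<in>B. i p = SNR)"

definition network_sum_capacity :: "nat \<Rightarrow> real \<Rightarrow> (nat \<times> nat \<Rightarrow> real) measure \<Rightarrow> real" where
  "network_sum_capacity K SNR D =
     sum_capacity K 1 (D \<Otimes>\<^sub>M phase_meas K)
       (\<lambda>(i, \<phi>) l r t. complex_of_real (if r = t then sqrt SNR else sqrt (i (r, t))) * cis (\<phi> (r, t)))"

definition bottleneck_state :: "nat \<Rightarrow> real \<Rightarrow> (nat \<times> nat) set \<Rightarrow> bool" where
  "bottleneck_state K SNR B \<longleftrightarrow>
     B \<subseteq> offdiag K \<and>
     (\<exists>c. \<forall>D. admissible_INR K SNR B D \<longrightarrow> network_sum_capacity K SNR D = c)"

definition minimal_bottleneck_state :: "nat \<Rightarrow> real \<Rightarrow> (nat \<times> nat) set \<Rightarrow> bool" where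
  "minimal_bottleneck_state K SNR B \<longleftrightarrow>
     bottleneck_state K SNR B \<and> (\<forall>B'. bottleneck_state K SNR B' \<longrightarrow> card B \<le> card B')"

text \<open>Fixed-strength channel states: A r t is the strength of the link t \<rightarrow> r.\<close>
definition fixed_state :: "nat \<Rightarrow> real \<Rightarrow> (nat \<Rightarrow> nat \<Rightarrow> real) \<Rightarrow> bool" where
  "fixed_state K SNR A \<longleftrightarrow> (\<forall>r<K. \<forall>t<K. 0 \<le> A r t) \<and> (\<forall>k<K. A k k = sqrt SNR)"

definition fixed_sum_capacity :: "nat \<Rightarrow> (nat \<Rightarrow> nat \<Rightarrow> real) \<Rightarrow> real" where
  "fixed_sum_capacity K A =
     sum_capacity K 1 (phase_meas K) (\<lambda>\<phi> l r t. complex_of_real (A r t) * cis (\<phi> (r, t)))"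

definition parallel_sum_capacity :: "nat \<Rightarrow> nat \<Rightarrow> (nat \<Rightarrow> nat \<Rightarrow> nat \<Rightarrow> real) \<Rightarrow> real" where
  "parallel_sum_capacity K L As =
     sum_capacity K L (PiM {..<L} (\<lambda>_. phase_meas K))
       (\<lambda>\<phi> l r t. complex_of_real (As l r t) * cis (\<phi> l (r, t)))"

definition separable :: "nat \<Rightarrow> nat \<Rightarrow> (nat \<Rightarrow> nat \<Rightarrow> nat \<Rightarrow> real) \<Rightarrow> bool" where
  "separable K L As \<longleftrightarrow> parallel_sum_capacity K L As = (\<Sum>l<L. fixed_sum_capacity K (As l))"

end

theory Submission
  imports Defs
begin

text \<open>
  The argument is purely operational. Let \<open>c\<close> be the common sum capacity of all networks with
  bottleneck set \<open>B\<close>, and consider the network whose strengths are, at each channel use,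
  drawn uniformly from the states \<open>A\<^sub>1, \<dots>, A\<^sub>L\<close>. All nodes know the whole state sequence, so
  in \<open>N' \<approx> (1 + \<delta>) L N\<close> uses of it one finds, with high probability, \<open>N\<close> uses of every \<open>A\<^sub>l\<close>,
  and these behave exactly like \<open>N\<close> uses of the parallel channel. Hence the parallel capacity is
  at most \<open>L c\<close>. On the other hand \<open>c\<close> is also the capacity of every single \<open>A\<^sub>l\<close>, and using the
  subchannels independently achieves the sum of their capacities.

  Since capacities are suprema of sets of reals, one also needs those sets to be bounded. Any crude
  bound suffices: a translate of the noise law has density at most \<open>2 exp |x|\<^sup>2\<close> per coordinate with
  respect to the Gaussian of variance 2, and the decision regions are disjoint.
\<close>

section \<open>Measure-preserving maps and Gaussian noise\<close>

text \<open>Two features of the model carry the simulation. Channel knowledge covers the whole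
  block, so encoders and decoders can agree, from the strengths alone, which channel use stands for
  which subchannel and time. And phases are independent of strengths, so fixing a strength sequence
  leaves the phases i.i.d. uniform. A law of strengths with finitely many atoms makes this
  conditioning elementary: the relevant sequences have positive probability, and totals over them
  are finite sums. Power survives because the \<open>L\<close> unit budgets of one parallel use are
  spent in \<open>L\<close> different uses of the mixture, while the remaining uses stay silent.

  Measurability of the error event is part of what a code is, so for each constructed code that
  event is determined exactly; an inclusion in a union would bound its probability only if it were
  known to be measurable. For this, a decoder that gives up answers with a number that is no
  message. Achievability also asks for codes at every large blocklength, so the number
  \<open>N\<close> of parallel uses is derived from the number \<open>N'\<close> of mixture uses and
  not conversely.\<close>

definition measure_preserving :: "('a \<Rightarrow> 'b) \<Rightarrow> 'a measure \<Rightarrow> 'b measure \<Rightarrow> bool" where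
  "measure_preserving f M N \<longleftrightarrow> f \<in> measurable M N \<and> distr M N f = N"

lemma measure_preserving_measurable: "measure_preserving f M N \<Longrightarrow> f \<in> measurable M N"
  by (simp add: measure_preserving_def)

lemma measure_preserving_comp:
  assumes "measure_preserving f M N" "measure_preserving g N P"
  shows "measure_preserving (\<lambda>x. g (f x)) M P"
proof -
  have "distr M P (\<lambda>x. g (f x)) = distr (distr M N f) P g"
    using assms by (subst distr_distr) (auto simp: measure_preserving_def comp_def)
  then show ?thesis
    using assms by (auto simp: measure_preserving_def intro: measurable_compose)
qed

lemma measure_preserving_cong:
  assumes "measure_preserving f M N" "\<And>x. x \<in> space M \<Longrightarrow> f x = g x"
  shows "measure_preserving g M N"
  using assms distr_cong[of M M N N f g] measurable_cong[of M f g N]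
  by (auto simp: measure_preserving_def)

lemma measure_preserving_emeasure:
  assumes "measure_preserving f M N" "X \<in> sets N"
  shows "emeasure M {x \<in> space M. f x \<in> X} = emeasure N X"
proof -
  have "emeasure (distr M N f) X = emeasure M (f -` X \<inter> space M)"
    using assms by (intro emeasure_distr) (auto simp: measure_preserving_def)
  also have "f -` X \<inter> space M = {x \<in> space M. f x \<in> X}" by auto
  finally show ?thesis using assms by (simp add: measure_preserving_def)
qed

lemma measure_preserving_measure:
  assumes "measure_preserving f M N" "X \<in> sets N"
  shows "measure M {x \<in> space M. f x \<in> X} = measure N X"
  using measure_preserving_emeasure[OF assms] by (simp add: measure_def)

lemma measure_preserving_nn_integral:
  assumes "measure_preserving f M N" "g \<in> borel_measurable N"
  shows "(\<integral>\<^sup>+x. g (f x) \<partial>M) = (\<integral>\<^sup>+x. g x \<partial>N)"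
  using assms nn_integral_distr[of f M N g] by (auto simp: measure_preserving_def)

lemma measure_preserving_integral:
  fixes g :: "_ \<Rightarrow> real"
  assumes "measure_preserving f M N" "g \<in> borel_measurable N"
  shows "(\<integral>x. g (f x) \<partial>M) = (\<integral>x. g x \<partial>N)"
  using assms integral_distr[of f M N g] by (auto simp: measure_preserving_def)

lemma measure_preserving_integrable:
  fixes g :: "_ \<Rightarrow> real"
  assumes "measure_preserving f M N" "integrable N g"
  shows "integrable M (\<lambda>x. g (f x))"
  using assms integrable_distr[of f M N g] by (auto simp: measure_preserving_def)

lemma measure_preserving_pair:
  assumes f: "measure_preserving f M N" and g: "measure_preserving g M' N'"
    and "prob_space N'"
  shows "measure_preserving (\<lambda>\<omega>. (f (fst \<omega>), g (snd \<omega>))) (M \<Otimes>\<^sub>M M') (N \<Otimes>\<^sub>M N')"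
proof -
  interpret prob_space N' by fact
  have "N \<Otimes>\<^sub>M N' = distr M N f \<Otimes>\<^sub>M distr M' N' g"
    using f g by (simp add: measure_preserving_def)
  also have "\<dots> = distr (M \<Otimes>\<^sub>M M') (N \<Otimes>\<^sub>M N') (\<lambda>(x, y). (f x, g y))"
    using f g sigma_finite_measure_axioms by (intro pair_measure_distr) (auto simp: measure_preserving_def)
  finally have "distr (M \<Otimes>\<^sub>M M') (N \<Otimes>\<^sub>M N') (\<lambda>\<omega>. (f (fst \<omega>), g (snd \<omega>))) = N \<Otimes>\<^sub>M N'"
    by (simp add: split_def)
  then show ?thesis
    using f g by (auto simp: measure_preserving_def)
qed

lemma measure_preserving_PiM:
  assumes "finite I" "prob_space M" "measure_preserving f M N"
  shows "measure_preserving (\<lambda>x. \<lambda>i\<in>I. f (x i)) (PiM I (\<lambda>_. M)) (PiM I (\<lambda>_. N))"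
proof -
  have [measurable]: "f \<in> measurable M N" using assms by (simp add: measure_preserving_def)
  have "prob_space N"
    using prob_space.prob_space_distr[OF assms(2) \<open>f \<in> measurable M N\<close>] assms(3)
    by (simp add: measure_preserving_def)
  then have "distr (PiM I (\<lambda>_. M)) (PiM I (\<lambda>_. N)) (compose I f) = PiM I (\<lambda>_. N)"
    using assms distr_PiM_finite_prob_space'[of I "\<lambda>_. M" "\<lambda>_. N" f]
    by (simp add: measure_preserving_def)
  then show ?thesis
    by (simp add: measure_preserving_def compose_def[abs_def])
qed

lemma measure_preserving_reindex:
  assumes "prob_space M" "inj_on f I" "f \<in> I \<rightarrow> J"
  shows "measure_preserving (\<lambda>x. \<lambda>i\<in>I. x (f i)) (PiM J (\<lambda>_. M)) (PiM I (\<lambda>_. M))"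
  using distr_PiM_reindex[of J "\<lambda>_. M" f I] assms
  by (auto simp: measure_preserving_def Pi_iff intro!: measurable_restrict)

lemma measure_preserving_component:
  assumes "prob_space M" "i \<in> I"
  shows "measure_preserving (\<lambda>x. x i) (PiM I (\<lambda>_. M)) M"
  using distr_PiM_component[of I "\<lambda>_. M" i] assms by (auto simp: measure_preserving_def)

text \<open>The joint law of all coordinates is the law of the identity, hence the product of the
  marginals, and this is independence. The characterisation used asks for a nonempty index set, so
  the empty one is treated apart.\<close>

lemma indep_vars_PiM_coordinates:
  assumes M: "prob_space M"
  shows "prob_space.indep_vars (PiM I (\<lambda>_. M)) (\<lambda>_. M) (\<lambda>i x. x i) I"
proof -
  let ?P = "PiM I (\<lambda>_. M)"
  interpret P: prob_space ?P using M by (intro prob_space_PiM)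
  have comp: "measure_preserving (\<lambda>x. x i) ?P M" if "i \<in> I" for i
    using measure_preserving_component[OF M that] .
  show ?thesis
  proof (cases "I = {}")
    case True
    then show ?thesis unfolding P.indep_vars_def P.indep_sets_def by auto
  next
    case False
    have "distr ?P ?P (\<lambda>x. \<lambda>i\<in>I. x i) = ?P"
      using measure_preserving_reindex[OF M, of "\<lambda>i. i" I I]
      by (simp add: measure_preserving_def)
    also have "\<dots> = PiM I (\<lambda>i. distr ?P M (\<lambda>x. x i))"
      using comp by (intro PiM_cong) (auto simp: measure_preserving_def)
    finally show ?thesis
      using False comp by (subst P.indep_vars_iff_distr_eq_PiM') (auto simp: measure_preserving_def)
  qed
qed

text \<open>The rows \<open>{i} \<times> J\<close> are disjoint blocks of independent coordinates,
  so they are independent of each other, and each row has law \<open>PiM J\<close>. This turns a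
  flat family of phases into a sequence of parallel states.\<close>

lemma measure_preserving_curry:
  assumes M: "prob_space M" 
  shows "measure_preserving (\<lambda>x. \<lambda>i\<in>I. \<lambda>j\<in>J. x (i, j)) (PiM (I \<times> J) (\<lambda>_. M))
    (PiM I (\<lambda>_. PiM J (\<lambda>_. M)))"
proof (cases "I = {}")
  case True
  \<comment> \<open>For empty \<open>I\<close> both sides are one-point spaces with counting
    measure.\<close>
  have "measure_preserving (\<lambda>_. b) (count_space {a}) (count_space {b})" for a :: 'd and b :: 'e
  proof -
    have "distr (count_space {a}) (count_space {b}) (\<lambda>_. b) = count_space {b}"
    proof (rule measure_eqI)
      fix A assume "A \<in> sets (distr (count_space {a}) (count_space {b}) (\<lambda>_. b))"
      then have "A = {} \<or> A = {b}" by auto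
      then show "emeasure (distr (count_space {a}) (count_space {b}) (\<lambda>_. b)) A = emeasure (count_space {b}) A"
        by (auto simp: emeasure_distr)
    qed simp
    then show ?thesis by (simp add: measure_preserving_def)
  qed
  then show ?thesis
    using True by (simp add: PiM_empty restrict_def)
next
  case False
  let ?P = "PiM (I \<times> J) (\<lambda>_. M)"
  interpret P: prob_space ?P using M by (intro prob_space_PiM)
  have ind: "P.indep_vars (\<lambda>_. M) (\<lambda>p x. x p) (I \<times> J)"
    by (rule indep_vars_PiM_coordinates[OF M])
  have "P.indep_vars (\<lambda>i. PiM ({i} \<times> J) (\<lambda>_. M)) (\<lambda>i x. restrict (\<lambda>p. x p) ({i} \<times> J)) I"
    by (intro P.indep_vars_restrict[OF ind]) (auto simp: disjoint_family_on_def)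
  then have "P.indep_vars (\<lambda>i. PiM J (\<lambda>_. M)) (\<lambda>i x. \<lambda>j\<in>J. restrict (\<lambda>p. x p) ({i} \<times> J) (i, j)) I"
    by (rule P.indep_vars_compose2[where Y = "\<lambda>i x. \<lambda>j\<in>J. x (i, j)"])
       (auto intro!: measurable_restrict)
  also have "(\<lambda>i x. \<lambda>j\<in>J. restrict (\<lambda>p. x p) ({i} \<times> J) (i, j)) = (\<lambda>i x. \<lambda>j\<in>J. x (i, j))"
    by (intro ext) auto
  finally have ind': "P.indep_vars (\<lambda>i. PiM J (\<lambda>_. M)) (\<lambda>i x. \<lambda>j\<in>J. x (i, j)) I" .
  have inner: "measure_preserving (\<lambda>x. \<lambda>j\<in>J. x (i, j)) ?P (PiM J (\<lambda>_. M))" if "i \<in> I" for i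
    using that by (intro measure_preserving_reindex[OF M]) (auto simp: inj_on_def)
  have "distr ?P (PiM I (\<lambda>_. PiM J (\<lambda>_. M))) (\<lambda>x. \<lambda>i\<in>I. \<lambda>j\<in>J. x (i, j)) =
      PiM I (\<lambda>i. distr ?P (PiM J (\<lambda>_. M)) (\<lambda>x. \<lambda>j\<in>J. x (i, j)))"
    using inner by (intro P.indep_vars_iff_distr_eq_PiM'[THEN iffD1, OF False _ ind'])
      (auto simp: measure_preserving_def)
  also have "\<dots> = PiM I (\<lambda>_. PiM J (\<lambda>_. M))"
    using inner by (intro PiM_cong) (auto simp: measure_preserving_def)
  finally show ?thesis
    by (auto simp: measure_preserving_def intro!: measurable_restrict)
qed

section \<open>Complex Gaussian laws and their translates\<close>

definition cgauss_var :: "real \<Rightarrow> complex measure" where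
  "cgauss_var v = density lborel (\<lambda>z. ennreal (exp (- (cmod z)\<^sup>2 / v) / (pi * v)))"

lemma cgauss_eq: "cgauss = cgauss_var 1"
  by (simp add: cgauss_def cgauss_var_def)

lemma sets_cgauss_var[simp, measurable_cong]: "sets (cgauss_var v) = sets borel"
  by (simp add: cgauss_var_def)

lemma sets_cgauss[simp, measurable_cong]: "sets cgauss = sets borel"
  by (simp add: cgauss_eq)

text \<open>The density splits into two real normal densities of variance \<open>v/2\<close>, for
  real and imaginary part, so \<open>v\<close> is the mean of \<open>|z|^2\<close>.\<close>

lemma prob_space_cgauss_var:
  assumes "v > 0"
  shows "prob_space (cgauss_var v)"
proof
  have N: "(\<integral>\<^sup>+x. ennreal (normal_density 0 (sqrt (v/2)) x) \<partial>lborel) = 1"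
    using prob_space.emeasure_space_1[OF prob_space_normal_density[of "sqrt (v/2)" 0]] assms
    by (simp add: emeasure_density)
  have *: "ennreal (exp (- (cmod z)\<^sup>2 / v) / (pi * v)) =
      (\<Prod>b\<in>Basis. ennreal (normal_density 0 (sqrt (v/2)) (z \<bullet> b)))" for z :: complex
  proof -
    have "exp (- (cmod z)\<^sup>2 / v) / (pi * v) =
       normal_density 0 (sqrt (v/2)) (Re z) * normal_density 0 (sqrt (v/2)) (Im z)"
      using assms
      by (simp add: normal_density_def cmod_power2 exp_add[symmetric] real_sqrt_mult[symmetric] field_simps
        add_divide_distrib[symmetric])
    then show ?thesis
      by (simp add: Basis_complex_def ennreal_mult inner_complex_def)
  qed
  have "emeasure (cgauss_var v) (space (cgauss_var v)) =
      (\<integral>\<^sup>+z. (\<Prod>b\<in>Basis. ennreal (normal_density 0 (sqrt (v/2)) (z \<bullet> b))) \<partial>(lborel :: complex measure))"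
    unfolding cgauss_var_def *[symmetric] by (simp add: emeasure_density)
  also have "\<dots> = (\<Prod>b\<in>(Basis :: complex set). (\<integral>\<^sup>+x. ennreal (normal_density 0 (sqrt (v/2)) x) \<partial>lborel))"
    by (rule nn_integral_lborel_prod) auto
  finally show "emeasure (cgauss_var v) (space (cgauss_var v)) = 1"
    by (simp add: N)
qed

lemma prob_space_cgauss: "prob_space cgauss"
  by (simp add: cgauss_eq prob_space_cgauss_var)

text \<open>Rests on \<open>|y|^2 / 2\<close> \<le> \<open>|y - x|^2 + |x|^2\<close>; the factor 2
  is the quotient of the normalising constants. The doubled variance is essential: no multiple of
  the noise density itself dominates its nontrivial translates. The reference law does not depend on
  \<open>x\<close>, so different codewords can be compared under it.\<close>

lemma nn_integral_cgauss_translate_le: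
  assumes [measurable]: "f \<in> borel_measurable borel"
  shows "(\<integral>\<^sup>+z. f (z + x) \<partial>cgauss) \<le> ennreal (2 * exp ((cmod x)\<^sup>2)) * (\<integral>\<^sup>+y. f y \<partial>cgauss_var 2)"
proof -
  let ?g = "\<lambda>v z. ennreal (exp (- (cmod z)\<^sup>2 / v) / (pi * v))"
  have le: "?g 1 (y - x) \<le> ennreal (2 * exp ((cmod x)\<^sup>2)) * ?g 2 y" for y
  proof -
    have "(cmod y)\<^sup>2 / 2 \<le> (cmod (y - x))\<^sup>2 + (cmod x)\<^sup>2"
    proof -
      have "cmod y \<le> cmod (y - x) + cmod x" using norm_triangle_ineq[of "y - x" x] by simp
      then have "(cmod y)\<^sup>2 \<le> (cmod (y - x) + cmod x)\<^sup>2" by (intro power_mono) auto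
      also have "\<dots> \<le> 2 * ((cmod (y - x))\<^sup>2 + (cmod x)\<^sup>2)"
        using sum_squares_bound[of "cmod (y - x)" "cmod x"] by (simp add: power2_sum)
      finally show ?thesis by simp
    qed
    then have "exp (- (cmod (y - x))\<^sup>2) \<le> exp ((cmod x)\<^sup>2) * exp (- (cmod y)\<^sup>2 / 2)"
      by (simp add: exp_add[symmetric])
    then have "exp (- (cmod (y - x))\<^sup>2 / 1) / (pi * 1) \<le>
        2 * exp ((cmod x)\<^sup>2) * (exp (- (cmod y)\<^sup>2 / 2) / (pi * 2))"
      by (simp add: divide_right_mono field_simps)
    then show ?thesis
      by (subst ennreal_mult[symmetric]) (auto intro: ennreal_leI)
  qed
  have "(\<integral>\<^sup>+z. f (z + x) \<partial>cgauss) = (\<integral>\<^sup>+z. ?g 1 z * f (z + x) \<partial>lborel)"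
    unfolding cgauss_eq cgauss_var_def by (subst nn_integral_density) auto
  also have "\<dots> = (\<integral>\<^sup>+z. ?g 1 (x + z - x) * f (x + z) \<partial>lborel)"
    by (simp add: add.commute)
  also have "\<dots> = (\<integral>\<^sup>+y. ?g 1 (y - x) * f y \<partial>distr lborel borel ((+) x))"
    by (subst nn_integral_distr) auto
  also have "\<dots> = (\<integral>\<^sup>+y. ?g 1 (y - x) * f y \<partial>lborel)"
    by (simp add: lborel_distr_plus)
  also have "\<dots> \<le> (\<integral>\<^sup>+y. ennreal (2 * exp ((cmod x)\<^sup>2)) * (?g 2 y * f y) \<partial>lborel)"
    unfolding mult.assoc[symmetric] by (intro nn_integral_mono mult_right_mono le) auto
  also have "\<dots> = ennreal (2 * exp ((cmod x)\<^sup>2)) * (\<integral>\<^sup>+y. f y \<partial>cgauss_var 2)"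
    unfolding cgauss_var_def by (subst nn_integral_cmult) (auto simp: nn_integral_density)
  finally show ?thesis .
qed

text \<open>One coordinate at a time: the one-dimensional bound applies with the other coordinates
  frozen, and the induction hypothesis then applies to \<open>?F\<close>, where the new coordinate
  is integrated out. Hence \<open>f\<close> must be arbitrary in the induction.\<close>

lemma nn_integral_PiM_cgauss_translate_le:
  assumes "finite I" "f \<in> borel_measurable (PiM I (\<lambda>_. borel))"
  shows "(\<integral>\<^sup>+z. f (\<lambda>i\<in>I. z i + x i) \<partial>PiM I (\<lambda>_. cgauss)) \<le>
    (\<Prod>i\<in>I. ennreal (2 * exp ((cmod (x i))\<^sup>2))) * (\<integral>\<^sup>+y. f y \<partial>PiM I (\<lambda>_. cgauss_var 2))"
  using assms
proof (induction I arbitrary: f rule: finite_induct)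
  case empty
  then show ?case by (simp add: PiM_empty nn_integral_count_space_finite restrict_def)
next
  case (insert i I)
  note [measurable] = insert.prems
  interpret G: product_sigma_finite "\<lambda>_. cgauss"
    by (simp add: product_sigma_finite_def prob_space_cgauss prob_space_imp_sigma_finite)
  interpret V: product_sigma_finite "\<lambda>_. cgauss_var 2"
    by (simp add: product_sigma_finite_def prob_space_cgauss_var prob_space_imp_sigma_finite)
  interpret VI: sigma_finite_measure "PiM I (\<lambda>_. cgauss_var 2)"
    by (intro prob_space_imp_sigma_finite prob_space_PiM prob_space_cgauss_var) auto
  interpret V2: sigma_finite_measure "cgauss_var 2"
    by (intro prob_space_imp_sigma_finite prob_space_cgauss_var) auto
  let ?c = "\<lambda>i. ennreal (2 * exp ((cmod (x i))\<^sup>2))"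
  let ?F = "\<lambda>y. \<integral>\<^sup>+u. f (y(i := u)) \<partial>cgauss_var 2"
  have F[measurable]: "?F \<in> borel_measurable (PiM I (\<lambda>_. borel))" 
    by measurable
  have "(\<integral>\<^sup>+z. f (\<lambda>j\<in>insert i I. z j + x j) \<partial>PiM (insert i I) (\<lambda>_. cgauss)) =
     (\<integral>\<^sup>+z. \<integral>\<^sup>+u. f (\<lambda>j\<in>insert i I. (z(i := u)) j + x j) \<partial>cgauss \<partial>PiM I (\<lambda>_. cgauss))"
    using insert.hyps by (intro G.product_nn_integral_insert) measurable
  also have "\<dots> = (\<integral>\<^sup>+z. \<integral>\<^sup>+u. f ((\<lambda>j\<in>I. z j + x j)(i := u + x i)) \<partial>cgauss \<partial>PiM I (\<lambda>_. cgauss))"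
    using insert.hyps by (intro nn_integral_cong arg_cong[where f = f]) (auto simp: fun_eq_iff)
  also have "\<dots> \<le> (\<integral>\<^sup>+z. ?c i * ?F (\<lambda>j\<in>I. z j + x j) \<partial>PiM I (\<lambda>_. cgauss))"
    by (intro nn_integral_mono nn_integral_cgauss_translate_le[where f = "\<lambda>u. f ((\<lambda>j\<in>I. _ j + x j)(i := u))"])
       (auto intro!: measurable_compose[OF _ insert.prems] measurable_fun_upd[where J = I] simp: space_PiM)
  also have "\<dots> = ?c i * (\<integral>\<^sup>+z. ?F (\<lambda>j\<in>I. z j + x j) \<partial>PiM I (\<lambda>_. cgauss))"
    by (intro nn_integral_cmult) measurable
  also have "\<dots> \<le> ?c i * ((\<Prod>i\<in>I. ?c i) * (\<integral>\<^sup>+y. ?F y \<partial>PiM I (\<lambda>_. cgauss_var 2)))"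
    by (intro mult_left_mono insert.IH F) auto
  also have "(\<integral>\<^sup>+y. ?F y \<partial>PiM I (\<lambda>_. cgauss_var 2)) = (\<integral>\<^sup>+y. f y \<partial>PiM (insert i I) (\<lambda>_. cgauss_var 2))"
    using insert.hyps by (intro V.product_nn_integral_insert[symmetric]) measurable
  finally show ?case
    using insert.hyps by (simp add: mult.assoc)
qed

section \<open>A crude converse\<close>

lemma prob_space_state_seq: "prob_space S \<Longrightarrow> prob_space (state_seq S N)"
  unfolding state_seq_def by (intro prob_space_PiM)

lemma prob_space_noise_seq: "prob_space (noise_seq K L N)"
  unfolding noise_seq_def by (intro prob_space_PiM prob_space_cgauss)

lemma prob_space_joint_space: "prob_space S \<Longrightarrow> prob_space (joint_space K L S N)"
  unfolding joint_space_def
  by (intro prob_space_pair prob_space_state_seq prob_space_noise_seq)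

lemma finite_msgs[simp]: "finite (msgs K M)"
  unfolding msgs_def by (intro finite_PiE) auto

lemma card_msgs: "card (msgs K M) = (\<Prod>k<K. M k)"
  unfolding msgs_def by (simp add: card_PiE)

section \<open>Fibres of message tuples and averages over them\<close>

lemma card_PiE_fiber:
  assumes "finite I" "i \<in> I" "y \<in> F i"
  shows "card {v \<in> PiE I F. v i = y} = (\<Prod>j\<in>I - {i}. card (F j))"
proof -
  have "{v \<in> PiE I F. v i = y} = PiE I (F(i := {y}))"
    using assms by (auto simp: PiE_iff extensional_def split: if_splits)
  also have "card \<dots> = (\<Prod>j\<in>I. card ((F(i := {y})) j))"
    using assms by (simp add: card_PiE)
  also have "\<dots> = (\<Prod>j\<in>I - {i}. card ((F(i := {y})) j))"
    using assms by (subst prod.remove[of I i]) auto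
  also have "\<dots> = (\<Prod>j\<in>I - {i}. card (F j))"
    by (intro prod.cong) auto
  finally show ?thesis .
qed

text \<open>Under a map with equal fibres, a uniform element has a uniform image. The averages are
  cross-multiplied, so empty sets need no separate treatment.\<close>

lemma sum_equidistributed:
  fixes g :: "'b \<Rightarrow> real"
  assumes "finite X" "finite Y" "\<And>x. x \<in> X \<Longrightarrow> f x \<in> Y"
    and "\<And>y. y \<in> Y \<Longrightarrow> card {x \<in> X. f x = y} = c"
  shows "(\<Sum>x\<in>X. g (f x)) * real (card Y) = real (card X) * (\<Sum>y\<in>Y. g y)"
proof -
  have *: "(\<Sum>x\<in>X. g (f x)) = real c * (\<Sum>y\<in>Y. g y)" for g :: "'b \<Rightarrow> real"
  proof -
    have "(\<Sum>x\<in>X. g (f x)) = (\<Sum>y\<in>Y. \<Sum>x\<in>{x \<in> X. f x = y}. g (f x))"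
      using assms by (intro sum.group[symmetric]) auto
    also have "\<dots> = (\<Sum>y\<in>Y. real c * g y)"
      using assms(4) by (intro sum.cong) auto
    finally show ?thesis by (simp add: sum_distrib_left)
  qed
  \<comment> \<open>The constant function \<open>1\<close> gives \<open>card X = c * card Y\<close>,
    which eliminates \<open>c\<close>.\<close>
  show ?thesis using *[of g] *[of "\<lambda>_. 1"] by simp
qed

text \<open>The power constraint averages over a transmitter's own message, errors over whole
  tuples; this converts the one average into the other.\<close>

lemma sum_msgs_coordinate:
  fixes g :: "nat \<Rightarrow> real"
  assumes "k < K"
  shows "(\<Sum>w\<in>msgs K M. g (w k)) * real (M k) = real (card (msgs K M)) * (\<Sum>m<M k. g m)"
proof -
  have "(\<Sum>w\<in>msgs K M. g (w k)) * real (card {..<M k}) = real (card (msgs K M)) * (\<Sum>m\<in>{..<M k}. g m)"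
  proof (rule sum_equidistributed)
    show "card {w \<in> msgs K M. w k = y} = (\<Prod>j\<in>{..<K} - {k}. card {..<M j})" if "y \<in> {..<M k}" for y
      using that assms unfolding msgs_def by (intro card_PiE_fiber) auto
  qed (use assms in \<open>auto simp: msgs_def PiE_iff intro!: finite_PiE\<close>)
  then show ?thesis by simp
qed

lemma cmod_sum_sq_le:
  fixes a x :: "nat \<Rightarrow> complex"
  assumes "\<And>t. t < K \<Longrightarrow> cmod (a t) \<le> G" "0 \<le> G"
  shows "(cmod (\<Sum>t<K. a t * x t))\<^sup>2 \<le> real K * G\<^sup>2 * (\<Sum>t<K. (cmod (x t))\<^sup>2)"
proof -
  have "cmod (\<Sum>t<K. a t * x t) \<le> (\<Sum>t<K. G * cmod (x t))"
    using assms by (intro sum_norm_le) (auto simp: norm_mult intro: mult_right_mono)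
  then have "(cmod (\<Sum>t<K. a t * x t))\<^sup>2 \<le> (\<Sum>t<K. G * cmod (x t))\<^sup>2"
    by (intro power_mono) auto
  also have "\<dots> \<le> (\<Sum>t<K. (G * cmod (x t))\<^sup>2) * card {..<K}"
    by (rule sum_squared_le_sum_of_squares)
  finally show ?thesis
    by (simp add: power_mult_distrib sum_distrib_left mult_ac)
qed

text \<open>All receivers are treated as one joint decoder, because only the joint error event is
  known to be measurable.\<close>
lemma correct_regions_disjoint:
  assumes C: "\<And>w. C w = {z. (s, z) \<in> space (joint_space K L S N) - err_event K L S N gain enc dec w}"
    and h: "\<And>w n l r. h w (n, l, r) = (\<Sum>t<K. gain (s n) l r t * enc t (w t) s n l)"
    and w: "w \<in> msgs K M" "w' \<in> msgs K M"
    and I: "I = {..<N} \<times> {..<L} \<times> {..<K}"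
    and y: "(\<lambda>i\<in>I. y i - h w i) \<in> C w" "(\<lambda>i\<in>I. y i - h w' i) \<in> C w'"
  shows "w = w'"
proof -
  \<comment> \<open>Adding the signal of \<open>v\<close> to this noise gives the output
    \<open>y\<close> whatever \<open>v\<close> is, so the decoders' answers depend on
    \<open>y\<close> only.\<close>
  have out: "chan_out K L N gain enc r v s (\<lambda>i\<in>I. y i - h v i) =
     (\<lambda>n l. if n < N \<and> l < L then y (n, l, r) else 0)" if "r < K" for r v
    using that by (auto simp: chan_out_def I h fun_eq_iff)
  have dec: "dec r (\<lambda>n l. if n < N \<and> l < L then y (n, l, r) else 0) s = v r"
    if "(\<lambda>i\<in>I. y i - h v i) \<in> C v" "r < K" for v r
    using that out[of r v] by (auto simp: C err_event_def)
  have "w r = w' r" if "r < K" for r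
    using dec[OF y(1) that] dec[OF y(2) that] by simp
  then show ?thesis
    using w unfolding msgs_def by (intro PiE_ext[of w "{..<K}" _ w']) auto
qed

text \<open>For a fixed state sequence, shift each region of correct decoding by its noiseless
  output \<open>h w\<close>. Up to a constant its noise probability is at most its mass under the
  variance-2 reference law, and the shifted regions are disjoint, so these masses add up to at most
  1. The constant has a factor 2 for each of the \<open>N * L * K\<close> noise coordinates; in the
  exponent, each of the \<open>K\<close> receivers collects at most \<open>K * G^2\<close> times the
  transmitted energy.\<close>

lemma sum_correct_prob_le:
  assumes S: "prob_space S" and G: "0 \<le> G"
    and s: "s \<in> space (state_seq S N)"
    and gb: "\<And>n l r t. n < N \<Longrightarrow> l < L \<Longrightarrow> r < K \<Longrightarrow> t < K \<Longrightarrow> cmod (gain (s n) l r t) \<le> G"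
    and meas: "\<And>w. w \<in> W \<Longrightarrow> err_event K L S N gain enc dec w \<in> sets (joint_space K L S N)"
    and W: "W \<subseteq> msgs K M"
    and T: "\<And>w. w \<in> W \<Longrightarrow> (\<Sum>t<K. \<Sum>n<N. \<Sum>l<L. (cmod (enc t (w t) s n l))\<^sup>2) \<le> T"
  shows "(\<Sum>w\<in>W. emeasure (noise_seq K L N)
            (Pair s -` (space (joint_space K L S N) - err_event K L S N gain enc dec w)))
     \<le> ennreal (2 ^ (N * L * K) * exp ((real K)\<^sup>2 * G\<^sup>2 * T))"
proof -
  define I where "I = {..<N} \<times> {..<L} \<times> {..<K}"
  define h where "h = (\<lambda>w (n, l, r). \<Sum>t<K. gain (s n) l r t * enc t (w t) s n l)"
  define C where "C = (\<lambda>w. {z. (s, z) \<in> space (joint_space K L S N) - err_event K L S N gain enc dec w})"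
  define f where "f = (\<lambda>w y. indicator (C w) (\<lambda>i\<in>I. y i - h w i) :: ennreal)"
  let ?c = "ennreal (2 ^ (N * L * K) * exp ((real K)\<^sup>2 * G\<^sup>2 * T))"
  let ?V = "PiM I (\<lambda>_. cgauss_var 2)"
  have I: "finite I" "card I = N * L * K" by (auto simp: I_def)
  have finW: "finite W" by (rule finite_subset[OF W finite_msgs])
  have Z: "noise_seq K L N = PiM I (\<lambda>_. cgauss)" by (simp add: noise_seq_def I_def)
  have sZ: "sets (PiM I (\<lambda>_. cgauss)) = sets (PiM I (\<lambda>_. borel))" by (intro sets_PiM_cong) auto
  have Cs: "C w \<in> sets (PiM I (\<lambda>_. borel))" if "w \<in> W" for w
  proof -
    have "Pair s -` (space (joint_space K L S N) - err_event K L S N gain enc dec w) \<in> sets (noise_seq K L N)"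
      using meas[OF that] by (intro sets_Pair1) (auto simp: joint_space_def)
    then show ?thesis by (simp add: Z sZ C_def vimage_def)
  qed
  have fm: "f w \<in> borel_measurable (PiM I (\<lambda>_. borel))" if "w \<in> W" for w
  proof -
    have [measurable]: "C w \<in> sets (PiM I (\<lambda>_. borel))" by (rule Cs[OF that])
    show ?thesis unfolding f_def by measurable
  qed
  have energy: "(\<Sum>i\<in>I. (cmod (h w i))\<^sup>2) \<le> (real K)\<^sup>2 * G\<^sup>2 * T" if "w \<in> W" for w
  proof -
    have "(\<Sum>i\<in>I. (cmod (h w i))\<^sup>2) \<le>
        (\<Sum>(n, l, r)\<in>I. real K * G\<^sup>2 * (\<Sum>t<K. (cmod (enc t (w t) s n l))\<^sup>2))"
      by (intro sum_mono) (auto simp: I_def h_def intro!: cmod_sum_sq_le gb G)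
    also have "\<dots> = (real K)\<^sup>2 * G\<^sup>2 * (\<Sum>n<N. \<Sum>l<L. \<Sum>t<K. (cmod (enc t (w t) s n l))\<^sup>2)"
      by (simp add: I_def sum.cartesian_product[symmetric] sum_distrib_left power2_eq_square mult_ac)
    also have "(\<Sum>n<N. \<Sum>l<L. \<Sum>t<K. (cmod (enc t (w t) s n l))\<^sup>2) =
        (\<Sum>n<N. \<Sum>t<K. \<Sum>l<L. (cmod (enc t (w t) s n l))\<^sup>2)"
      by (intro sum.cong refl sum.swap)
    also have "\<dots> = (\<Sum>t<K. \<Sum>n<N. \<Sum>l<L. (cmod (enc t (w t) s n l))\<^sup>2)"
      by (rule sum.swap)
    also have "(real K)\<^sup>2 * G\<^sup>2 * \<dots> \<le> (real K)\<^sup>2 * G\<^sup>2 * T"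
      by (intro mult_left_mono T that) auto
    finally show ?thesis .
  qed
  have one: "emeasure (noise_seq K L N) (C w) \<le> ?c * (\<integral>\<^sup>+y. f w y \<partial>?V)" if "w \<in> W" for w
  proof -
    have "emeasure (noise_seq K L N) (C w) = (\<integral>\<^sup>+z. indicator (C w) z \<partial>PiM I (\<lambda>_. cgauss))"
      using Cs[OF that] by (simp add: Z sZ)
    also have "\<dots> = (\<integral>\<^sup>+z. f w (\<lambda>i\<in>I. z i + h w i) \<partial>PiM I (\<lambda>_. cgauss))"
    proof (rule nn_integral_cong)
      fix z assume "z \<in> space (PiM I (\<lambda>_. cgauss))"
      then have "(\<lambda>i\<in>I. (\<lambda>i\<in>I. z i + h w i) i - h w i) = z"
        by (auto simp: space_PiM PiE_iff extensional_def fun_eq_iff)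
      then show "indicator (C w) z = f w (\<lambda>i\<in>I. z i + h w i)"
        by (simp add: f_def)
    qed
    also have "\<dots> \<le> (\<Prod>i\<in>I. ennreal (2 * exp ((cmod (h w i))\<^sup>2))) * (\<integral>\<^sup>+y. f w y \<partial>?V)"
      by (intro nn_integral_PiM_cgauss_translate_le I fm that)
    also have "(\<Prod>i\<in>I. ennreal (2 * exp ((cmod (h w i))\<^sup>2))) = ennreal (\<Prod>i\<in>I. 2 * exp ((cmod (h w i))\<^sup>2))"
      by (intro prod_ennreal) auto
    also have "(\<Prod>i\<in>I. 2 * exp ((cmod (h w i))\<^sup>2)) = 2 ^ (N * L * K) * exp (\<Sum>i\<in>I. (cmod (h w i))\<^sup>2)"
      using I by (simp add: prod.distrib exp_sum)
    also have "ennreal \<dots> \<le> ?c"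
      using energy[OF that] by (intro ennreal_leI mult_left_mono) auto
    finally show ?thesis by (simp add: mult_right_mono)
  qed
  \<comment> \<open>An output \<open>y\<close> is decoded correctly for at most one message
    tuple.\<close>
  have disj: "(\<Sum>w\<in>W. f w y) \<le> 1" for y
  proof (cases "\<exists>w\<in>W. f w y \<noteq> 0")
    case True
    then obtain w where w: "w \<in> W" "f w y \<noteq> 0" by auto
    have "f w' y = 0" if "w' \<in> W - {w}" for w'
    proof (rule ccontr)
      assume "f w' y \<noteq> 0"
      then have "w = w'"
        using w that W by (intro correct_regions_disjoint[where C = C and h = h and I = I and y = y])
          (auto simp: C_def h_def I_def f_def indicator_def split: if_splits)
      then show False using that by simp
    qed
    then have "(\<Sum>w\<in>W. f w y) = f w y"
      using finW w by (subst sum.remove[of W w]) auto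
    then show ?thesis by (simp add: f_def indicator_def)
  qed (simp add: sum.neutral)
  have "(\<Sum>w\<in>W. emeasure (noise_seq K L N) (C w)) \<le> (\<Sum>w\<in>W. ?c * (\<integral>\<^sup>+y. f w y \<partial>?V))"
    by (intro sum_mono one)
  also have "\<dots> = ?c * (\<integral>\<^sup>+y. (\<Sum>w\<in>W. f w y) \<partial>?V)"
  proof -
    have "sets ?V = sets (PiM I (\<lambda>_. borel))" by (intro sets_PiM_cong) auto
    then have "f w \<in> borel_measurable ?V" if "w \<in> W" for w
      using fm[OF that] measurable_cong_sets by blast
    then show ?thesis by (subst nn_integral_sum) (auto simp: sum_distrib_left)
  qed
  also have "\<dots> \<le> ?c * (\<integral>\<^sup>+y. 1 \<partial>?V)"
    by (intro mult_left_mono nn_integral_mono disj) auto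
  also have "(\<integral>\<^sup>+y. 1 \<partial>?V) = 1"
    using prob_space.emeasure_space_1[OF prob_space_PiM[of I "\<lambda>_. cgauss_var 2"]]
    by (simp add: prob_space_cgauss_var)
  finally show ?thesis by (simp add: C_def vimage_def)
qed

text \<open>Power is constrained only on average over messages, states and time, so a single
  codeword may have any energy; what is bounded is the total over all tuples.\<close>

lemma valid_code_energy:
  assumes v: "valid_code K L S N gain M enc dec"
  defines "e \<equiv> (\<lambda>w s. \<Sum>t<K. \<Sum>n<N. \<Sum>l<L. (cmod (enc t (w t) s n l))\<^sup>2)"
  shows "\<And>w. w \<in> msgs K M \<Longrightarrow> integrable (state_seq S N) (e w)"
    and "(\<Sum>w\<in>msgs K M. \<integral>s. e w s \<partial>state_seq S N) \<le> real (card (msgs K M)) * (real K * real L * real N)"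
proof -
  let ?S = "state_seq S N" and ?W = "msgs K M"
  have int: "integrable ?S (\<lambda>s. (cmod (enc t m s n l))\<^sup>2)" if "t < K" "m < M t" "n < N" "l < L" for t m n l
    using v that by (auto simp: valid_code_def)
  have wM: "w t < M t" if "w \<in> ?W" "t < K" for w t
    using that by (auto simp: msgs_def PiE_iff)
  show "integrable ?S (e w)" if "w \<in> ?W" for w
    unfolding e_def using wM[OF that] by (intro Bochner_Integration.integrable_sum int) auto
  have pw: "(\<Sum>n<N. \<Sum>m<M t. \<integral>s. (cmod (enc t m s n l))\<^sup>2 \<partial>?S) \<le> real N * real (M t)"
    if "t < K" "l < L" for t l
    using v that by (auto simp: valid_code_def)
  define g where "g = (\<lambda>t m. \<Sum>l<L. \<Sum>n<N. \<integral>s. (cmod (enc t m s n l))\<^sup>2 \<partial>?S)"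
  have g: "(\<Sum>m<M t. g t m) \<le> real L * real N * real (M t)" if "t < K" for t
  proof -
    have "(\<Sum>m<M t. g t m) = (\<Sum>l<L. \<Sum>m<M t. \<Sum>n<N. \<integral>s. (cmod (enc t m s n l))\<^sup>2 \<partial>?S)"
      unfolding g_def by (rule sum.swap)
    also have "\<dots> = (\<Sum>l<L. \<Sum>n<N. \<Sum>m<M t. \<integral>s. (cmod (enc t m s n l))\<^sup>2 \<partial>?S)"
      by (intro sum.cong refl sum.swap)
    also have "\<dots> \<le> (\<Sum>l<L. real N * real (M t))"
      using that by (intro sum_mono pw) auto
    finally show ?thesis by simp
  qed
  have "(\<Sum>w\<in>?W. \<integral>s. e w s \<partial>?S) = (\<Sum>w\<in>?W. \<Sum>t<K. g t (w t))"
  proof (rule sum.cong[OF refl])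
    fix w assume w: "w \<in> ?W"
    have "(\<integral>s. e w s \<partial>?S) = (\<Sum>t<K. \<Sum>n<N. \<Sum>l<L. \<integral>s. (cmod (enc t (w t) s n l))\<^sup>2 \<partial>?S)"
      unfolding e_def using wM[OF w]
      by (subst Bochner_Integration.integral_sum,
          (intro Bochner_Integration.integrable_sum int; simp)?,
          intro sum.cong refl)+
    also have "\<dots> = (\<Sum>t<K. g t (w t))"
      unfolding g_def by (intro sum.cong refl sum.swap)
    finally show "(\<integral>s. e w s \<partial>?S) = (\<Sum>t<K. g t (w t))" .
  qed
  also have "\<dots> = (\<Sum>t<K. \<Sum>w\<in>?W. g t (w t))" by (rule sum.swap)
  also have "\<dots> \<le> (\<Sum>t<K. real (card ?W) * (real L * real N))"
  proof (rule sum_mono)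
    fix t assume "t \<in> {..<K}"
    then have t: "t < K" by simp
    then have M: "0 < M t" using v by (auto simp: valid_code_def)
    have "(\<Sum>w\<in>?W. g t (w t)) * real (M t) \<le> (real (card ?W) * (real L * real N)) * real (M t)"
      using mult_left_mono[OF g[OF t], of "real (card ?W)"] sum_msgs_coordinate[OF t, of "g t" M]
      by (simp add: mult_ac)
    then show "(\<Sum>w\<in>?W. g t (w t)) \<le> real (card ?W) * (real L * real N)"
      using M by (simp only: mult_le_cancel_right_pos of_nat_0_less_iff)
  qed
  also have "\<dots> = real (card ?W) * (real K * real L * real N)" by simp
  finally show "(\<Sum>w\<in>?W. \<integral>s. e w s \<partial>?S) \<le> real (card ?W) * (real K * real L * real N)" .
qed

text \<open>Pairs of a message tuple and a state sequence with energy at least \<open>T\<close> are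
  discarded. By Markov's inequality this loses at most a quarter of the total weight
  \<open>card (msgs K M)\<close>, and decoding errors lose at most another quarter. The remaining
  half is correct decoding at bounded energy, which the pointwise estimate limits to
  \<open>c\<close>; hence the factor 2.\<close>

lemma code_size_bound:
  assumes S: "prob_space S" and G: "0 \<le> G"
    and gb: "AE s in S. \<forall>l<L. \<forall>r<K. \<forall>t<K. cmod (gain s l r t) \<le> G"
    and v: "valid_code K L S N gain M enc dec"
    and err: "err_prob K L S N gain M enc dec \<le> 1/4"
  shows "real (card (msgs K M)) \<le>
    2 * (2 ^ (N * L * K) * exp ((real K)\<^sup>2 * G\<^sup>2 * (4 * real K * real L * real N + 1)))"
proof -
  let ?S = "state_seq S N" and ?W = "msgs K M" and ?Z = "noise_seq K L N" and ?J = "joint_space K L S N"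
  let ?err = "err_event K L S N gain enc dec"
  \<comment> \<open>Four times the bound on the mean energy, which gives the quarter in Markov's
    inequality; the \<open>+ 1\<close> keeps \<open>T\<close> positive when \<open>K * L * N\<close>
    is zero.\<close>
  define T where "T = 4 * real K * real L * real N + 1"
  define e where "e = (\<lambda>w s. \<Sum>t<K. \<Sum>n<N. \<Sum>l<L. (cmod (enc t (w t) s n l))\<^sup>2)"
  define c where "c = 2 ^ (N * L * K) * exp ((real K)\<^sup>2 * G\<^sup>2 * T)"
  define C where "C = (\<lambda>w. space ?J - ?err w)"
  define Q where "Q = (\<lambda>w. {s \<in> space ?S. T \<le> e w s})"
  define E where "E = (\<lambda>w. C w - Q w \<times> space ?Z)"
  interpret S: prob_space ?S by (intro prob_space_state_seq S)
  interpret Z: prob_space ?Z by (rule prob_space_noise_seq)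
  interpret J: prob_space ?J by (intro prob_space_joint_space S)
  have J: "?J = ?S \<Otimes>\<^sub>M ?Z" by (simp add: joint_space_def)
  have T: "T > 0" by (simp add: T_def add_nonneg_pos)
  have Wpos: "0 < card ?W"
    using v by (auto simp: card_msgs valid_code_def intro!: prod_pos)
  have errm: "?err w \<in> sets ?J" if "w \<in> ?W" for w
    using v that by (auto simp: valid_code_def)
  have eint: "integrable ?S (e w)" if "w \<in> ?W" for w
    using valid_code_energy(1)[OF v that] by (simp add: e_def)
  have Qm: "Q w \<in> sets ?S" if "w \<in> ?W" for w
  proof -
    have [measurable]: "e w \<in> borel_measurable ?S" using eint[OF that] by simp
    show ?thesis unfolding Q_def by measurable
  qed
  have Cm: "C w \<in> sets ?J" if "w \<in> ?W" for w
    using errm[OF that] by (auto simp: C_def)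
  have QZm: "Q w \<times> space ?Z \<in> sets ?J" if "w \<in> ?W" for w
    using Qm[OF that] by (auto simp: J)
  have Em: "E w \<in> sets ?J" if "w \<in> ?W" for w
    unfolding E_def using Cm[OF that] QZm[OF that] by auto
  have AEb: "AE s in ?S. \<forall>n\<in>{..<N}. \<forall>l<L. \<forall>r<K. \<forall>t<K. cmod (gain (s n) l r t) \<le> G"
    unfolding state_seq_def by (intro AE_finite_allI finite_lessThan AE_PiM_component gb S)
  have bound: "(\<Sum>w\<in>?W. emeasure ?J (E w)) \<le> ennreal c"
  proof -
    have "(\<Sum>w\<in>?W. emeasure ?J (E w)) = (\<Sum>w\<in>?W. \<integral>\<^sup>+s. emeasure ?Z (Pair s -` E w) \<partial>?S)"
      using Em by (intro sum.cong refl) (simp add: J Z.emeasure_pair_measure_alt)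
    also have "\<dots> = (\<integral>\<^sup>+s. (\<Sum>w\<in>?W. emeasure ?Z (Pair s -` E w)) \<partial>?S)"
      using Em by (intro nn_integral_sum[symmetric] Z.measurable_emeasure_Pair) (auto simp: J)
    also have "\<dots> \<le> (\<integral>\<^sup>+s. ennreal c \<partial>?S)"
    proof (rule nn_integral_mono_AE)
      show "AE s in ?S. (\<Sum>w\<in>?W. emeasure ?Z (Pair s -` E w)) \<le> ennreal c"
        using AEb AE_space
      proof eventually_elim
        case (elim s)
        \<comment> \<open>Which messages have low energy depends on the state sequence, so the
          pointwise estimate is applied to a set of messages that varies with
          \<open>s\<close>.\<close>
        define W' where "W' = {w \<in> ?W. e w s < T}"
        have "(\<Sum>w\<in>?W. emeasure ?Z (Pair s -` E w)) = (\<Sum>w\<in>W'. emeasure ?Z (Pair s -` C w))"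
        proof (rule sum.mono_neutral_cong_right)
          show "\<forall>w\<in>?W - W'. emeasure ?Z (Pair s -` E w) = 0"
          proof
            fix w assume "w \<in> ?W - W'"
            then have "s \<in> Q w" using elim by (auto simp: W'_def Q_def)
            then have "Pair s -` E w = {}"
              by (auto simp: E_def C_def J space_pair_measure)
            then show "emeasure ?Z (Pair s -` E w) = 0" by simp
          qed
          show "emeasure ?Z (Pair s -` E w) = emeasure ?Z (Pair s -` C w)" if "w \<in> W'" for w
          proof -
            have "s \<notin> Q w" using that by (auto simp: W'_def Q_def)
            then have "Pair s -` E w = Pair s -` C w" by (auto simp: E_def)
            then show ?thesis by simp
          qed
        qed (auto simp: W'_def)
        also have "\<dots> \<le> ennreal c"
          unfolding C_def c_def using elim errm
          by (intro sum_correct_prob_le[OF S G]) (auto simp: W'_def e_def)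
        finally show ?case .
      qed
    qed
    also have "\<dots> = ennreal c" by (simp add: S.emeasure_space_1)
    finally show ?thesis .
  qed
  have bound': "(\<Sum>w\<in>?W. measure ?J (E w)) \<le> c"
  proof -
    have "ennreal (\<Sum>w\<in>?W. measure ?J (E w)) \<le> ennreal c"
      using bound by (simp add: J.emeasure_eq_measure)
    then show ?thesis by (subst (asm) ennreal_le_iff) (auto simp: c_def)
  qed
  have split: "1 - measure ?J (?err w) \<le> measure ?J (E w) + (\<integral>s. e w s \<partial>?S) / T" if w: "w \<in> ?W" for w
  proof -
    have "1 - measure ?J (?err w) = measure ?J (C w)"
      unfolding C_def using errm[OF w] by (simp add: J.prob_compl)
    also have "\<dots> \<le> measure ?J (E w \<union> Q w \<times> space ?Z)"
      using Cm[OF w] QZm[OF w] by (intro J.finite_measure_mono) (auto simp: E_def)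
    also have "\<dots> \<le> measure ?J (E w) + measure ?J (Q w \<times> space ?Z)"
      using Em[OF w] QZm[OF w] by (intro measure_Un_le) auto
    also have "measure ?J (Q w \<times> space ?Z) = measure ?S (Q w)"
      using Qm[OF w] by (simp add: J measure_def Z.emeasure_pair_measure_Times Z.emeasure_space_1)
    also have "measure ?S (Q w) \<le> (\<integral>s. e w s \<partial>?S) / T"
      unfolding Q_def using eint[OF w] T
      by (intro integral_Markov_inequality_measure[where A = "{}"]) (auto simp: e_def intro!: sum_nonneg)
    finally show ?thesis by simp
  qed
  have "real (card ?W) - (\<Sum>w\<in>?W. measure ?J (?err w)) = (\<Sum>w\<in>?W. 1 - measure ?J (?err w))"
    by (simp add: sum_subtractf)
  also have "\<dots> \<le> (\<Sum>w\<in>?W. measure ?J (E w) + (\<integral>s. e w s \<partial>?S) / T)"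
    by (intro sum_mono split)
  also have "\<dots> = (\<Sum>w\<in>?W. measure ?J (E w)) + (\<Sum>w\<in>?W. \<integral>s. e w s \<partial>?S) / T"
    by (simp add: sum.distrib sum_divide_distrib)
  also have "\<dots> \<le> c + real (card ?W) / 4"
  proof (rule add_mono[OF bound'])
    have "(\<Sum>w\<in>?W. \<integral>s. e w s \<partial>?S) \<le> real (card ?W) * (real K * real L * real N)"
      using valid_code_energy(2)[OF v] by (simp add: e_def)
    also have "\<dots> \<le> real (card ?W) * (T / 4)"
      by (intro mult_left_mono) (auto simp: T_def)
    finally show "(\<Sum>w\<in>?W. \<integral>s. e w s \<partial>?S) / T \<le> real (card ?W) / 4"
      using T by (simp add: field_simps)
  qed
  finally have "real (card ?W) - (\<Sum>w\<in>?W. measure ?J (?err w)) \<le> c + real (card ?W) / 4" .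
  moreover have "(\<Sum>w\<in>?W. measure ?J (?err w)) \<le> real (card ?W) / 4"
    using err Wpos by (simp add: err_prob_def field_simps)
  ultimately have "real (card ?W) \<le> 2 * c" by simp
  then show ?thesis by (simp add: c_def T_def)
qed

text \<open>The number of message tuples grows at most exponentially in \<open>N\<close>, so the
  bound follows on taking logarithms and letting \<open>N\<close> grow. Its shape, proportional to
  \<open>L\<close>, also settles the channel without subchannels.\<close>

lemma converse_bound:
  assumes S: "prob_space S" and G: "0 \<le> G"
    and gb: "AE s in S. \<forall>l<L. \<forall>r<K. \<forall>t<K. cmod (gain s l r t) \<le> G"
    and a: "achievable K L S gain R"
  shows "(\<Sum>k<K. R k) \<le> real L * (real K + 4 * real K ^ 3 * G\<^sup>2 / ln 2)"
proof -
  \<comment> \<open>\<open>A\<close> is the part of the exponent linear in \<open>N\<close>: one bit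
    per noise coordinate and the term \<open>4 * K * L * N\<close> of the energy threshold.
    \<open>B\<close> holds the rest, from the leading factor 2 and the \<open>+ 1\<close> of the
    threshold.\<close>
  define A where "A = real L * (real K + 4 * real K ^ 3 * G\<^sup>2 / ln 2)"
  define B where "B = 1 + (real K)\<^sup>2 * G\<^sup>2 / ln 2"
  obtain N0 where N0: "\<And>N. N \<ge> N0 \<Longrightarrow> \<exists>M enc dec. valid_code K L S N gain M enc dec \<and>
      (\<forall>k<K. 2 powr (real N * R k) \<le> real (M k)) \<and> err_prob K L S N gain M enc dec \<le> 1/4"
    using a unfolding achievable_def by (metis zero_less_divide_1_iff zero_less_numeral)
  have le: "real N * (\<Sum>k<K. R k) \<le> B + real N * A" if "N \<ge> N0" for N
  proof -
    obtain M enc dec where c: "valid_code K L S N gain M enc dec"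
      "\<And>k. k < K \<Longrightarrow> 2 powr (real N * R k) \<le> real (M k)" "err_prob K L S N gain M enc dec \<le> 1/4"
      using N0[OF \<open>N \<ge> N0\<close>] by blast
    have "2 powr (real N * (\<Sum>k<K. R k)) = (\<Prod>k<K. 2 powr (real N * R k))"
      by (simp add: powr_sum sum_distrib_left)
    also have "\<dots> \<le> (\<Prod>k<K. real (M k))"
      using c(2) by (intro prod_mono) auto
    also have "\<dots> = real (card (msgs K M))" by (simp add: card_msgs)
    also have "\<dots> \<le> 2 * (2 ^ (N * L * K) * exp ((real K)\<^sup>2 * G\<^sup>2 * (4 * real K * real L * real N + 1)))"
      by (rule code_size_bound[OF S G gb c(1,3)])
    also have "\<dots> = 2 powr (B + real N * A)"
    proof -
      have "exp x = 2 powr (x / ln 2)" for x :: real by (simp add: powr_def)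
      then have "2 * (2 ^ (N * L * K) * exp ((real K)\<^sup>2 * G\<^sup>2 * (4 * real K * real L * real N + 1))) =
        2 powr 1 * (2 powr real (N * L * K) * 2 powr ((real K)\<^sup>2 * G\<^sup>2 * (4 * real K * real L * real N + 1) / ln 2))"
        by (simp only: powr_realpow[of 2] powr_one zero_less_numeral zero_le_numeral)
      also have "\<dots> = 2 powr (1 + (real (N * L * K) + (real K)\<^sup>2 * G\<^sup>2 * (4 * real K * real L * real N + 1) / ln 2))"
        by (simp add: powr_add)
      also have "1 + (real (N * L * K) + (real K)\<^sup>2 * G\<^sup>2 * (4 * real K * real L * real N + 1) / ln 2) = B + real N * A"
        by (simp add: A_def B_def field_simps power2_eq_square power3_eq_cube)
      finally show ?thesis .
    qed
    finally show ?thesis by simp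
  qed
  have "(\<Sum>k<K. R k) \<le> A"
  proof (rule ccontr)
    assume "\<not> ?thesis"
    then have d: "(\<Sum>k<K. R k) - A > 0" by simp
    obtain N where N: "B < real N * ((\<Sum>k<K. R k) - A)"
      using reals_Archimedean3[OF d] by blast
    have "real N * ((\<Sum>k<K. R k) - A) \<le> real (max N N0) * ((\<Sum>k<K. R k) - A)"
      using d by (intro mult_right_mono) auto
    also have "\<dots> \<le> B" using le[of "max N N0"] by (simp add: algebra_simps)
    finally show False using N by simp
  qed
  then show ?thesis by (simp add: A_def)
qed

section \<open>Independent use of the subchannels\<close>

lemma bij_betw_fiber_card:
  assumes "bij_betw b A (PiE I F)" "finite I" "i \<in> I" "y \<in> F i"
  shows "card {m \<in> A. b m i = y} = (\<Prod>j\<in>I - {i}. card (F j))"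
proof -
  have "bij_betw b {m \<in> A. b m i = y} {v \<in> PiE I F. v i = y}"
    using assms(1) unfolding bij_betw_def by (auto intro: inj_on_subset)
  then have "card {m \<in> A. b m i = y} = card {v \<in> PiE I F. v i = y}"
    by (rule bij_betw_same_card)
  then show ?thesis using card_PiE_fiber[of I i y F] assms(2-4) by simp
qed

text \<open>The states of different subchannels may be dependent, since the error is controlled by a
  union bound.\<close>
lemma parallel_code:
  fixes T :: "nat \<Rightarrow> 't measure" and S :: "'s measure"
  assumes S: "prob_space S" and h: "\<And>l. l < L \<Longrightarrow> measure_preserving (h l) S (T l)"
    and gain: "\<And>s l r t. s \<in> space S \<Longrightarrow> l < L \<Longrightarrow> r < K \<Longrightarrow> t < K \<Longrightarrow> gain s l r t = g l (h l s) 0 r t"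
    and code: "\<And>l. l < L \<Longrightarrow> valid_code K 1 (T l) N (g l) (Ml l) (E l) (D l)"
    and N: "0 < N"
  shows "\<exists>enc dec. valid_code K L S N gain (\<lambda>k. \<Prod>l<L. Ml l k) enc dec \<and>
     err_prob K L S N gain (\<lambda>k. \<Prod>l<L. Ml l k) enc dec \<le> (\<Sum>l<L. err_prob K 1 (T l) N (g l) (Ml l) (E l) (D l))"
proof -
  define M where "M = (\<lambda>k. \<Prod>l<L. Ml l k)"
  \<comment> \<open>Messages are natural numbers, so a tuple of component messages, one per
    subchannel, has to be numbered.\<close>
  have "\<exists>b. bij_betw b {..<M k} (PiE {..<L} (\<lambda>l. {..<Ml l k}))" for k
    by (rule finite_same_card_bij) (auto simp: M_def card_PiE intro!: finite_PiE)
  then obtain \<beta> where \<beta>: "\<And>k. bij_betw (\<beta> k) {..<M k} (PiE {..<L} (\<lambda>l. {..<Ml l k}))"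
    by metis
  have \<beta>in: "\<beta> k m \<in> PiE {..<L} (\<lambda>l. {..<Ml l k})" if "m < M k" for k m
    using \<beta>[of k] that by (auto simp: bij_betw_def)
  define hN where "hN = (\<lambda>l s. \<lambda>n\<in>{..<N}. h l (s n))"
  define zp where "zp = (\<lambda>l (z :: nat \<times> nat \<times> nat \<Rightarrow> complex). \<lambda>i\<in>{..<N} \<times> {..<1::nat} \<times> {..<K}. z (fst i, l, snd (snd i)))"
  define \<Phi> where "\<Phi> = (\<lambda>l \<omega>. (hN l (fst \<omega>), zp l (snd \<omega>)))"
  define enc where "enc = (\<lambda>k m s n l. E l k (\<beta> k m l) (hN l s) n 0)"
  define yl where "yl = (\<lambda>l (y :: nat \<Rightarrow> nat \<Rightarrow> complex) n l'. if n < N \<and> l' < (1::nat) then y n l else 0)"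
  define vec where "vec = (\<lambda>r y s. \<lambda>l\<in>{..<L}. D l r (yl l y) (hN l s))"
  \<comment> \<open>A tuple of answers outside the range is sent to \<open>M r\<close>, which is no
    message. Thus \<open>dec\<close> is right exactly when all component decoders are right.\<close>
  define dec where "dec = (\<lambda>r y s. if vec r y s \<in> PiE {..<L} (\<lambda>l. {..<Ml l r})
     then inv_into {..<M r} (\<beta> r) (vec r y s) else M r)"
  define wl where "wl = (\<lambda>l w. \<lambda>k\<in>{..<K}. \<beta> k (w k) l)"
  let ?J = "joint_space K L S N" and ?Jl = "\<lambda>l. joint_space K 1 (T l) N"
  let ?err = "err_event K L S N gain enc dec" and ?errl = "\<lambda>l. err_event K 1 (T l) N (g l) (E l) (D l)"
  interpret J: prob_space ?J by (intro prob_space_joint_space S)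
  have hN: "measure_preserving (hN l) (state_seq S N) (state_seq (T l) N)" if "l < L" for l
    unfolding hN_def state_seq_def by (intro measure_preserving_PiM S h that) auto
  have zp: "measure_preserving (zp l) (noise_seq K L N) (noise_seq K 1 N)" if "l < L" for l
    unfolding zp_def noise_seq_def using that
    by (intro measure_preserving_reindex prob_space_cgauss) (auto simp: inj_on_def)
  have \<Phi>: "measure_preserving (\<Phi> l) ?J (?Jl l)" if "l < L" for l
    unfolding \<Phi>_def joint_space_def
    by (intro measure_preserving_pair hN zp that prob_space_noise_seq)
  have wl: "wl l w \<in> msgs K (Ml l)" if "l < L" "w \<in> msgs K M" for l w
    using that \<beta>in by (force simp: wl_def msgs_def PiE_iff)
  have out: "chan_out K 1 N (g l) (E l) r (wl l w) (hN l s) (zp l z) = yl l (chan_out K L N gain enc r w s z)"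
    if "l < L" "r < K" "s \<in> space (state_seq S N)" for l r w s z
  proof -
    have "s n \<in> space S" if "n < N" for n
      using that \<open>s \<in> _\<close> by (auto simp: state_seq_def space_PiM PiE_iff)
    then show ?thesis
      using that by (auto simp: fun_eq_iff chan_out_def yl_def zp_def wl_def enc_def hN_def gain)
  qed
  have dec_eq: "dec r y s = w r \<longleftrightarrow> (\<forall>l<L. D l r (yl l y) (hN l s) = \<beta> r (w r) l)"
    if "r < K" "w \<in> msgs K M" for r y s w
  proof -
    have wr: "w r < M r" using that by (auto simp: msgs_def PiE_iff)
    have "dec r y s = w r \<longleftrightarrow> vec r y s = \<beta> r (w r)"
    proof
      assume "dec r y s = w r"
      with wr have v: "vec r y s \<in> PiE {..<L} (\<lambda>l. {..<Ml l r})" "inv_into {..<M r} (\<beta> r) (vec r y s) = w r"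
        by (auto simp: dec_def split: if_splits)
      then show "vec r y s = \<beta> r (w r)"
        using \<beta>[of r] by (metis bij_betw_inv_into_right)
    next
      assume v: "vec r y s = \<beta> r (w r)"
      then show "dec r y s = w r"
        using \<beta>in[OF wr] \<beta>[of r] wr by (simp add: dec_def bij_betw_inv_into_left[OF \<beta>])
    qed
    also have "\<dots> \<longleftrightarrow> (\<forall>l<L. D l r (yl l y) (hN l s) = \<beta> r (w r) l)"
    proof
      assume "\<forall>l<L. D l r (yl l y) (hN l s) = \<beta> r (w r) l"
      then show "vec r y s = \<beta> r (w r)"
        using \<beta>in[OF wr] by (auto simp: vec_def fun_eq_iff PiE_iff extensional_def)
    next
      assume "vec r y s = \<beta> r (w r)"
      moreover have "vec r y s l = D l r (yl l y) (hN l s)" if "l < L" for l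
        using that by (simp add: vec_def)
      ultimately show "\<forall>l<L. D l r (yl l y) (hN l s) = \<beta> r (w r) l" by simp
    qed
    finally show ?thesis .
  qed
  \<comment> \<open>An equality, since it must also supply the measurability of the joint error
    event.\<close>
  have err: "?err w = (\<Union>l\<in>{..<L}. {\<omega> \<in> space ?J. \<Phi> l \<omega> \<in> ?errl l (wl l w)})" if w: "w \<in> msgs K M" for w
  proof -
    have "(\<omega> \<in> ?err w) = (\<exists>l<L. \<Phi> l \<omega> \<in> ?errl l (wl l w))" if \<omega>: "\<omega> \<in> space ?J" for \<omega>
    proof -
      have s: "fst \<omega> \<in> space (state_seq S N)"
        using \<omega> by (auto simp: joint_space_def space_pair_measure)
      have "\<Phi> l \<omega> \<in> space (?Jl l)" if "l < L" for l
        using measurable_space[OF measure_preserving_measurable[OF \<Phi>[OF that]] \<omega>] .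
      then have part: "\<Phi> l \<omega> \<in> ?errl l (wl l w) \<longleftrightarrow>
          (\<exists>r<K. D l r (yl l (chan_out K L N gain enc r w (fst \<omega>) (snd \<omega>))) (hN l (fst \<omega>)) \<noteq> \<beta> r (w r) l)"
        if "l < L" for l
        using out[OF that _ s] that by (auto simp: err_event_def \<Phi>_def wl_def)
      have "\<omega> \<in> ?err w \<longleftrightarrow>
          (\<exists>r<K. \<exists>l<L. D l r (yl l (chan_out K L N gain enc r w (fst \<omega>) (snd \<omega>))) (hN l (fst \<omega>)) \<noteq> \<beta> r (w r) l)"
        using dec_eq[OF _ w] \<omega> by (simp add: err_event_def) blast
      then show ?thesis using part by blast
    qed
    moreover have "?err w \<subseteq> space ?J" by (auto simp: err_event_def)
    ultimately show ?thesis by blast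
  qed
  have errlm: "?errl l w \<in> sets (?Jl l)" if "l < L" "w \<in> msgs K (Ml l)" for l w
    using code[OF that(1)] that(2) by (auto simp: valid_code_def)
  have pre: "{\<omega> \<in> space ?J. \<Phi> l \<omega> \<in> ?errl l (wl l w)} \<in> sets ?J" if "l < L" "w \<in> msgs K M" for l w
  proof -
    have [measurable]: "\<Phi> l \<in> measurable ?J (?Jl l)" "?errl l (wl l w) \<in> sets (?Jl l)"
      using measure_preserving_measurable[OF \<Phi>] errlm wl that by auto
    show ?thesis by measurable
  qed
  have Mpos: "0 < Ml l k" if "l < L" "k < K" for l k
    using code[OF that(1)] that by (auto simp: valid_code_def)
  \<comment> \<open>A uniform joint message has uniform components, so the power constraint of each
    component code carries over to its subchannel.\<close>
  have avg_enc: "(\<Sum>m<M k. G (\<beta> k m l)) * real (Ml l k) = real (M k) * (\<Sum>j<Ml l k. G j)"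
    if "l < L" for G :: "nat \<Rightarrow> real" and k l
  proof -
    have "(\<Sum>m\<in>{..<M k}. G (\<beta> k m l)) * real (card {..<Ml l k}) = real (card {..<M k}) * (\<Sum>j\<in>{..<Ml l k}. G j)"
    proof (rule sum_equidistributed)
      show "card {m \<in> {..<M k}. \<beta> k m l = y} = (\<Prod>j\<in>{..<L} - {l}. card {..<Ml j k})" if "y \<in> {..<Ml l k}" for y
        using that \<open>l < L\<close> by (intro bij_betw_fiber_card[OF \<beta>]) auto
    qed (use \<beta>in that in \<open>auto simp: PiE_iff\<close>)
    then show ?thesis by simp
  qed
  have avg_msg: "(\<Sum>w\<in>msgs K M. G (wl l w)) * real (card (msgs K (Ml l))) =
      real (card (msgs K M)) * (\<Sum>w\<in>msgs K (Ml l). G w)"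
    if l: "l < L" for G :: "(nat \<Rightarrow> nat) \<Rightarrow> real" and l
  proof (rule sum_equidistributed)
    fix w' assume w': "w' \<in> msgs K (Ml l)"
    have "{w \<in> msgs K M. wl l w = w'} = PiE {..<K} (\<lambda>k. {m \<in> {..<M k}. \<beta> k m l = w' k})"
      using w' by (auto simp: msgs_def wl_def PiE_iff fun_eq_iff extensional_def)
    then have "card {w \<in> msgs K M. wl l w = w'} = (\<Prod>k<K. card {m \<in> {..<M k}. \<beta> k m l = w' k})"
      by (simp add: card_PiE)
    also have "\<dots> = (\<Prod>k<K. \<Prod>j\<in>{..<L} - {l}. card {..<Ml j k})"
      using w' l by (intro prod.cong refl bij_betw_fiber_card[OF \<beta>]) (auto simp: msgs_def PiE_iff)
    finally show "card {w \<in> msgs K M. wl l w = w'} = (\<Prod>k<K. \<Prod>j\<in>{..<L} - {l}. card {..<Ml j k})" .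
  qed (use wl l in auto)
  have "valid_code K L S N gain M enc dec"
    unfolding valid_code_def
  proof (intro conjI allI impI ballI)
    show "0 < M k" if "k < K" for k
      unfolding M_def using Mpos that by (intro prod_pos) auto
    show "?err w \<in> sets ?J" if "w \<in> msgs K M" for w
      unfolding err[OF that] using pre that by (intro sets.finite_UN) auto
  next
    fix k m n l assume *: "k < K" "m < M k" "n < N" "l < L"
    have "\<beta> k m l < Ml l k" using \<beta>in[OF *(2)] * by (auto simp: PiE_iff)
    then have **: "(\<lambda>s. E l k (\<beta> k m l) s n 0) \<in> borel_measurable (state_seq (T l) N)"
      "integrable (state_seq (T l) N) (\<lambda>s. (cmod (E l k (\<beta> k m l) s n 0))\<^sup>2)"
      using code[OF *(4)] * by (auto simp: valid_code_def)
    show "(\<lambda>s. enc k m s n l) \<in> borel_measurable (state_seq S N)"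
      unfolding enc_def
      using measurable_compose[OF measure_preserving_measurable[OF hN[OF *(4)]] **(1)] .
    show "integrable (state_seq S N) (\<lambda>s. (cmod (enc k m s n l))\<^sup>2)"
      unfolding enc_def
      using measure_preserving_integrable[OF hN[OF *(4)] **(2)] .
  next
    fix k l assume *: "k < K" "l < L"
    define G where "G = (\<lambda>n j. \<integral>s. (cmod (E l k j s n 0))\<^sup>2 \<partial>state_seq (T l) N)"
    have eq: "(\<integral>s. (cmod (enc k m s n l))\<^sup>2 \<partial>state_seq S N) = G n (\<beta> k m l)" if "n < N" "m < M k" for n m
    proof -
      have "\<beta> k m l < Ml l k" using \<beta>in[OF that(2)] * by (auto simp: PiE_iff)
      then have [measurable]: "(\<lambda>s. E l k (\<beta> k m l) s n 0) \<in> borel_measurable (state_seq (T l) N)"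
        using code[OF *(2)] * that by (auto simp: valid_code_def)
      show ?thesis
        unfolding enc_def G_def
        by (intro measure_preserving_integral[OF hN[OF *(2)], where g = "\<lambda>s. (cmod (E l k (\<beta> k m l) s n 0))\<^sup>2"]) measurable
    qed
    have "(\<Sum>n<N. \<Sum>m<M k. \<integral>s. (cmod (enc k m s n l))\<^sup>2 \<partial>state_seq S N) * real (Ml l k) =
        (\<Sum>n<N. (\<Sum>m<M k. G n (\<beta> k m l)) * real (Ml l k))"
      using eq by (simp add: sum_distrib_right)
    also have "\<dots> = real (M k) * (\<Sum>n<N. \<Sum>j<Ml l k. G n j)"
      using avg_enc[OF *(2)] by (simp add: sum_distrib_left)
    also have "\<dots> \<le> real (M k) * (real N * real (Ml l k))"
      using code[OF *(2)] * by (intro mult_left_mono) (auto simp: valid_code_def G_def)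
    finally show "(\<Sum>n<N. \<Sum>m<M k. \<integral>s. (cmod (enc k m s n l))\<^sup>2 \<partial>state_seq S N) \<le> real N * real (M k)"
      using Mpos[OF *(2,1)] by (simp add: mult_ac)
  qed (rule N)
  moreover have "err_prob K L S N gain M enc dec \<le> (\<Sum>l<L. err_prob K 1 (T l) N (g l) (Ml l) (E l) (D l))"
  proof -
    define G where "G = (\<lambda>l w. measure (?Jl l) (?errl l w))"
    have Wpos: "0 < card (msgs K M)"
      unfolding card_msgs M_def using Mpos by (intro prod_pos) auto
    have "measure ?J (?err w) \<le> (\<Sum>l<L. G l (wl l w))" if w: "w \<in> msgs K M" for w
    proof -
      have "measure ?J (?err w) \<le> (\<Sum>l\<in>{..<L}. measure ?J {\<omega> \<in> space ?J. \<Phi> l \<omega> \<in> ?errl l (wl l w)})"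
        unfolding err[OF w] using pre w by (intro measure_UNION_le) auto
      also have "\<dots> = (\<Sum>l<L. G l (wl l w))"
        unfolding G_def using errlm wl w by (intro sum.cong refl measure_preserving_measure \<Phi>) auto
      finally show ?thesis .
    qed
    then have "(\<Sum>w\<in>msgs K M. measure ?J (?err w)) \<le> (\<Sum>w\<in>msgs K M. \<Sum>l<L. G l (wl l w))"
      by (intro sum_mono)
    also have "\<dots> = (\<Sum>l<L. \<Sum>w\<in>msgs K M. G l (wl l w))" by (rule sum.swap)
    also have "\<dots> = (\<Sum>l<L. real (card (msgs K M)) * ((\<Sum>w\<in>msgs K (Ml l). G l w) / real (card (msgs K (Ml l)))))"
    proof (intro sum.cong refl)
      fix l assume "l \<in> {..<L}"
      then have "l < L" by simp
      then have "0 < card (msgs K (Ml l))" unfolding card_msgs using Mpos by (intro prod_pos) auto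
      then show "(\<Sum>w\<in>msgs K M. G l (wl l w)) =
          real (card (msgs K M)) * ((\<Sum>w\<in>msgs K (Ml l). G l w) / real (card (msgs K (Ml l))))"
        using avg_msg[OF \<open>l < L\<close>, of "G l"] by (subst times_divide_eq_right, subst eq_divide_eq) auto
    qed
    also have "\<dots> = (\<Sum>l<L. err_prob K 1 (T l) N (g l) (Ml l) (E l) (D l)) * real (card (msgs K M))"
      by (simp add: err_prob_def G_def sum_distrib_left mult.commute)
    finally show ?thesis
      using Wpos by (simp add: err_prob_def divide_le_eq)
  qed
  ultimately show ?thesis unfolding M_def by blast
qed

text \<open>Serves two purposes. With the coordinate projections as \<open>h\<close> it uses the
  subchannels independently; with \<open>L = 1\<close> it transports achievability back along any
  measure-preserving map of states that respects the gains.\<close>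

lemma achievable_parallel:
  fixes T :: "nat \<Rightarrow> 't measure" and S :: "'s measure"
  assumes S: "prob_space S" and h: "\<And>l. l < L \<Longrightarrow> measure_preserving (h l) S (T l)"
    and gain: "\<And>s l r t. s \<in> space S \<Longrightarrow> l < L \<Longrightarrow> r < K \<Longrightarrow> t < K \<Longrightarrow> gain s l r t = g l (h l s) 0 r t"
    and ach: "\<And>l. l < L \<Longrightarrow> achievable K 1 (T l) (g l) (R l)"
  shows "achievable K L S gain (\<lambda>k. \<Sum>l<L. R l k)"
  unfolding achievable_def
proof (intro conjI allI impI)
  show "0 \<le> (\<Sum>l<L. R l k)" if "k < K" for k
    using ach that by (auto simp: achievable_def intro!: sum_nonneg)
next
  fix \<epsilon> :: real assume "\<epsilon> > 0"
  \<comment> \<open>The \<open>+ 1\<close> covers \<open>L = 0\<close>.\<close>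
  define \<epsilon>' where "\<epsilon>' = \<epsilon> / (real L + 1)"
  have \<epsilon>': "\<epsilon>' > 0" using \<open>\<epsilon> > 0\<close> by (simp add: \<epsilon>'_def)
  have "\<forall>l. \<exists>N0. l < L \<longrightarrow> (\<forall>N\<ge>N0. \<exists>M enc dec. valid_code K 1 (T l) N (g l) M enc dec \<and>
        (\<forall>k<K. 2 powr (real N * R l k) \<le> real (M k)) \<and>
        err_prob K 1 (T l) N (g l) M enc dec \<le> \<epsilon>')"
    using ach \<epsilon>' by (auto simp: achievable_def)
  then obtain N0 where N0: "\<And>l N. l < L \<Longrightarrow> N \<ge> N0 l \<Longrightarrow> \<exists>M enc dec. valid_code K 1 (T l) N (g l) M enc dec \<and>
        (\<forall>k<K. 2 powr (real N * R l k) \<le> real (M k)) \<and>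
        err_prob K 1 (T l) N (g l) M enc dec \<le> \<epsilon>'"
    by metis
  show "\<exists>N0. \<forall>N\<ge>N0. \<exists>M enc dec. valid_code K L S N gain M enc dec \<and>
        (\<forall>k<K. 2 powr (real N * (\<Sum>l<L. R l k)) \<le> real (M k)) \<and>
        err_prob K L S N gain M enc dec \<le> \<epsilon>"
  \<comment> \<open>The sum exceeds every single threshold, and the extra 1 keeps the blocklength
    positive even without subchannels.\<close>
  proof (intro exI[of _ "1 + (\<Sum>l<L. N0 l)"] allI impI)
    fix N assume N: "N \<ge> 1 + (\<Sum>l<L. N0 l)"
    have "N \<ge> N0 l" if "l < L" for l
      using N member_le_sum[of l "{..<L}" N0] that by auto
    then have "\<forall>l. \<exists>M enc dec. l < L \<longrightarrow> valid_code K 1 (T l) N (g l) M enc dec \<and>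
        (\<forall>k<K. 2 powr (real N * R l k) \<le> real (M k)) \<and>
        err_prob K 1 (T l) N (g l) M enc dec \<le> \<epsilon>'"
      using N0 by meson
    then obtain Ml E D where c: "\<And>l. l < L \<Longrightarrow> valid_code K 1 (T l) N (g l) (Ml l) (E l) (D l)"
      "\<And>l k. l < L \<Longrightarrow> k < K \<Longrightarrow> 2 powr (real N * R l k) \<le> real (Ml l k)"
      "\<And>l. l < L \<Longrightarrow> err_prob K 1 (T l) N (g l) (Ml l) (E l) (D l) \<le> \<epsilon>'"
      by metis
    obtain enc dec where ed: "valid_code K L S N gain (\<lambda>k. \<Prod>l<L. Ml l k) enc dec"
      "err_prob K L S N gain (\<lambda>k. \<Prod>l<L. Ml l k) enc dec \<le> (\<Sum>l<L. err_prob K 1 (T l) N (g l) (Ml l) (E l) (D l))"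
      using parallel_code[where gain = gain and L = L, OF S h gain c(1)] N by (auto simp del: One_nat_def)
    have "(\<Sum>l<L. err_prob K 1 (T l) N (g l) (Ml l) (E l) (D l)) \<le> (\<Sum>l<L. \<epsilon>')"
      using c(3) by (intro sum_mono) auto
    also have "\<dots> \<le> \<epsilon>" using \<open>\<epsilon> > 0\<close> by (simp add: \<epsilon>'_def field_simps)
    finally have "err_prob K L S N gain (\<lambda>k. \<Prod>l<L. Ml l k) enc dec \<le> \<epsilon>" using ed(2) by simp
    moreover have "2 powr (real N * (\<Sum>l<L. R l k)) \<le> real (\<Prod>l<L. Ml l k)" if "k < K" for k
    proof -
      have "2 powr (real N * (\<Sum>l<L. R l k)) = (\<Prod>l<L. 2 powr (real N * R l k))"
        by (simp add: powr_sum sum_distrib_left)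
      also have "\<dots> \<le> (\<Prod>l<L. real (Ml l k))" using c(2) that by (intro prod_mono) auto
      finally show ?thesis by simp
    qed
    ultimately show "\<exists>M enc dec. valid_code K L S N gain M enc dec \<and>
        (\<forall>k<K. 2 powr (real N * (\<Sum>l<L. R l k)) \<le> real (M k)) \<and>
        err_prob K L S N gain M enc dec \<le> \<epsilon>"
      using ed(1) by blast
  qed
qed

section \<open>Simulating the parallel channel by a mixture\<close>

text \<open>Strength and phases are independent within a channel use, and the uses are independent.
  So the probability of a box of phases together with the strengths \<open>v\<close> factors, and
  dividing by the probability of \<open>v\<close> leaves the unconditioned law of the
  phases.\<close>

lemma measure_preserving_conditioned_phases:
  assumes D: "prob_space D" and P: "prob_space P"
    and v: "\<And>n. n < N \<Longrightarrow> {v n} \<in> sets D" "\<And>n. n < N \<Longrightarrow> measure D {v n} > 0"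
  defines "\<Omega> \<equiv> state_seq (D \<Otimes>\<^sub>M P) N"
  defines "A \<equiv> {s \<in> space \<Omega>. \<forall>n<N. fst (s n) = v n}"
  shows "A \<in> sets \<Omega>" "emeasure \<Omega> A > 0"
    "measure_preserving (\<lambda>s. \<lambda>n\<in>{..<N}. snd (s n)) (uniform_measure \<Omega> A) (PiM {..<N} (\<lambda>_. P))"
proof -
  interpret D: prob_space D by fact
  interpret P: prob_space P by fact
  interpret DP: pair_prob_space D P ..
  interpret O: prob_space \<Omega> unfolding \<Omega>_def by (intro prob_space_state_seq DP.prob_space_axioms)
  interpret PDP: product_prob_space "\<lambda>_. D \<Otimes>\<^sub>M P" "{..<N}"
    by (simp add: product_prob_spaceI DP.prob_space_axioms)
  interpret PP: product_prob_space "\<lambda>_. P" "{..<N}"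
    by (simp add: product_prob_spaceI P.prob_space_axioms)
  \<comment> \<open>The factorisation from which both the probability of \<open>A\<close> and the
    conditional law are read off.\<close>
  have box: "emeasure \<Omega> (PiE {..<N} (\<lambda>n. {v n} \<times> B n)) = (\<Prod>n<N. emeasure D {v n}) * (\<Prod>n<N. emeasure P (B n))"
    if "\<And>n. n < N \<Longrightarrow> B n \<in> sets P" for B
  proof -
    have "emeasure \<Omega> (PiE {..<N} (\<lambda>n. {v n} \<times> B n)) = (\<Prod>n<N. emeasure (D \<Otimes>\<^sub>M P) ({v n} \<times> B n))"
      unfolding \<Omega>_def state_seq_def using that v by (intro PDP.emeasure_PiM) auto
    also have "\<dots> = (\<Prod>n<N. emeasure D {v n} * emeasure P (B n))"
      using that v by (intro prod.cong refl P.emeasure_pair_measure_Times) auto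
    finally show ?thesis by (simp add: prod.distrib)
  qed
  have vsp: "v n \<in> space D" if "n < N" for n using sets.sets_into_space[OF v(1)[OF that]] by auto
  have AP: "A = PiE {..<N} (\<lambda>n. {v n} \<times> space P)"
    unfolding A_def \<Omega>_def state_seq_def space_PiM space_pair_measure
    using vsp by (intro set_eqI) (auto simp: PiE_iff mem_Times_iff)
  show Am: "A \<in> sets \<Omega>"
    unfolding AP \<Omega>_def state_seq_def using v by (intro sets_PiM_I_finite) auto
  have EA: "emeasure \<Omega> A = (\<Prod>n<N. emeasure D {v n})"
    unfolding AP by (subst box) (auto simp: P.emeasure_space_1)
  have EA': "emeasure \<Omega> A = ennreal (\<Prod>n<N. measure D {v n})"
    unfolding EA by (simp add: D.emeasure_eq_measure prod_ennreal)
  have pos: "(\<Prod>n<N. measure D {v n}) > 0" using v(2) by (intro prod_pos) auto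
  then show posA: "emeasure \<Omega> A > 0" by (simp add: EA')
  let ?f = "\<lambda>s. \<lambda>n\<in>{..<N}. snd (s n)"
  have fm0: "?f \<in> measurable \<Omega> (PiM {..<N} (\<lambda>_. P))"
    unfolding \<Omega>_def state_seq_def by measurable
  then have fm: "?f \<in> measurable (uniform_measure \<Omega> A) (PiM {..<N} (\<lambda>_. P))" by simp
  have "distr (uniform_measure \<Omega> A) (PiM {..<N} (\<lambda>_. P)) ?f = PiM {..<N} (\<lambda>_. P)"
  proof (rule PP.PiM_eqI)
    fix B assume B: "\<And>n. n \<in> {..<N} \<Longrightarrow> B n \<in> sets P"
    then have Bm: "PiE {..<N} B \<in> sets (PiM {..<N} (\<lambda>_. P))" by (intro sets_PiM_I_finite) auto
    have eq: "A \<inter> (?f -` PiE {..<N} B \<inter> space \<Omega>) = PiE {..<N} (\<lambda>n. {v n} \<times> B n)"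
    proof -
      have "x \<in> space P" if "n < N" "x \<in> B n" for n x
        using sets.sets_into_space[OF B[of n]] that by auto
      then show ?thesis
        using vsp unfolding A_def \<Omega>_def state_seq_def space_PiM space_pair_measure
        by (intro set_eqI) (auto simp: PiE_iff mem_Times_iff)
    qed
    have "emeasure (distr (uniform_measure \<Omega> A) (PiM {..<N} (\<lambda>_. P)) ?f) (PiE {..<N} B) =
       emeasure (uniform_measure \<Omega> A) (?f -` PiE {..<N} B \<inter> space \<Omega>)"
      using fm Bm by (subst emeasure_distr) auto
    also have "\<dots> = emeasure \<Omega> (A \<inter> (?f -` PiE {..<N} B \<inter> space \<Omega>)) / emeasure \<Omega> A"
      using Am measurable_sets[OF fm0 Bm] by (intro emeasure_uniform_measure) auto
    also have "\<dots> = (emeasure \<Omega> A * (\<Prod>n<N. emeasure P (B n))) / emeasure \<Omega> A"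
      unfolding eq using B by (subst box) (auto simp: EA)
    also have "\<dots> = (\<Prod>n<N. emeasure P (B n))"
      using posA by (subst mult.commute, intro mult_divide_eq_ennreal) auto
    finally show "emeasure (distr (uniform_measure \<Omega> A) (PiM {..<N} (\<lambda>_. P)) ?f) (PiE {..<N} B) =
        (\<Prod>n<N. emeasure P (B n))" .
  qed auto
  then show "measure_preserving ?f (uniform_measure \<Omega> A) (PiM {..<N} (\<lambda>_. P))"
    using fm by (simp add: measure_preserving_def)
qed

text \<open>Injectivity of \<open>p\<close> is what keeps the phases of different subchannels and
  times independent: no channel use is taken twice.\<close>

lemma measure_preserving_select:
  assumes P: "prob_space P" and p: "inj_on p ({..<N} \<times> {..<L})" "p ` ({..<N} \<times> {..<L}) \<subseteq> {..<N'}"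
  shows "measure_preserving (\<lambda>g. \<lambda>n\<in>{..<N}. \<lambda>l\<in>{..<L}. g (p (n, l))) (PiM {..<N'} (\<lambda>_. P))
     (state_seq (PiM {..<L} (\<lambda>_. P)) N)"
proof -
  have "measure_preserving (\<lambda>g. \<lambda>x\<in>{..<N} \<times> {..<L}. g (p x)) (PiM {..<N'} (\<lambda>_. P)) (PiM ({..<N} \<times> {..<L}) (\<lambda>_. P))"
    using p by (intro measure_preserving_reindex P) auto
  from measure_preserving_comp[OF this measure_preserving_curry[OF P]]
  show ?thesis
    unfolding state_seq_def
    by (rule measure_preserving_cong) (auto simp: fun_eq_iff)
qed

text \<open>Here \<open>v\<close> is a realised sequence of strengths, and channel use \<open>p (n, l)\<close> plays the role of
  subchannel \<open>l\<close> at time \<open>n\<close>.\<close>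
lemma measure_preserving_conditioned_select:
  assumes D: "prob_space D" and P: "prob_space P"
    and v: "\<And>n. n < N' \<Longrightarrow> {v n} \<in> sets D" "\<And>n. n < N' \<Longrightarrow> measure D {v n} > 0"
    and p: "inj_on p ({..<N} \<times> {..<L})" "p ` ({..<N} \<times> {..<L}) \<subseteq> {..<N'}"
  defines "\<Omega> \<equiv> state_seq (D \<Otimes>\<^sub>M P) N'"
  defines "A \<equiv> {s \<in> space \<Omega>. \<forall>n<N'. fst (s n) = v n}"
  shows "measure_preserving (\<lambda>s. \<lambda>n\<in>{..<N}. \<lambda>l\<in>{..<L}. snd (s (p (n, l)))) (uniform_measure \<Omega> A)
     (state_seq (PiM {..<L} (\<lambda>_. P)) N)"
proof -
  have "measure_preserving (\<lambda>s. \<lambda>n\<in>{..<N'}. snd (s n)) (uniform_measure \<Omega> A) (PiM {..<N'} (\<lambda>_. P))"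
    unfolding \<Omega>_def A_def by (intro measure_preserving_conditioned_phases[OF D P] v)
  from measure_preserving_comp[OF this measure_preserving_select[OF P p]]
  show ?thesis
    by (rule measure_preserving_cong) (use p in \<open>auto simp: fun_eq_iff\<close>)
qed

section \<open>Integrals and probabilities restricted to one strength pattern\<close>

lemma mult_divide_cancel_ennreal: "0 < c \<Longrightarrow> c \<noteq> top \<Longrightarrow> c * (x / c) = (x :: ennreal)"
  using mult_divide_eq_ennreal[of c x] by (simp add: ennreal_times_divide mult.commute)

text \<open>The contribution of one pattern to an expectation, written under the unconditioned law
  so that the energies of finitely many patterns can be added.\<close>

lemma integral_conditioned:
  fixes f :: "'b \<Rightarrow> real"
  assumes O: "prob_space \<Omega>" and A: "A \<in> sets \<Omega>" "emeasure \<Omega> A > 0"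
    and st: "st \<in> measurable \<Omega> X" and mp: "measure_preserving st (uniform_measure \<Omega> A) X"
    and f: "integrable X f" "\<And>x. 0 \<le> f x"
  shows "has_bochner_integral \<Omega> (\<lambda>s. indicator A s * f (st s)) (measure \<Omega> A * (\<integral>x. f x \<partial>X))"
proof -
  interpret prob_space \<Omega> by fact
  have [measurable]: "f \<in> borel_measurable X" "st \<in> measurable \<Omega> X" "A \<in> sets \<Omega>" using f st A by auto
  have "(\<integral>\<^sup>+s. ennreal (f (st s)) \<partial>uniform_measure \<Omega> A) = (\<integral>\<^sup>+x. ennreal (f x) \<partial>X)"
    by (rule measure_preserving_nn_integral[OF mp]) measurable
  also have "(\<integral>\<^sup>+s. ennreal (f (st s)) \<partial>uniform_measure \<Omega> A) =
      (\<integral>\<^sup>+s. ennreal (f (st s)) * indicator A s \<partial>\<Omega>) / emeasure \<Omega> A"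
    by (rule nn_integral_uniform_measure) auto
  finally have "(\<integral>\<^sup>+x. ennreal (f x) \<partial>X) = (\<integral>\<^sup>+s. ennreal (f (st s)) * indicator A s \<partial>\<Omega>) / emeasure \<Omega> A" ..
  then have "(\<integral>\<^sup>+s. ennreal (f (st s)) * indicator A s \<partial>\<Omega>) = emeasure \<Omega> A * (\<integral>\<^sup>+x. ennreal (f x) \<partial>X)"
    using mult_divide_cancel_ennreal[of "emeasure \<Omega> A"] A(2) by simp
  also have "(\<integral>\<^sup>+x. ennreal (f x) \<partial>X) = ennreal (\<integral>x. f x \<partial>X)"
    using f by (intro nn_integral_eq_integral) auto
  finally have *: "(\<integral>\<^sup>+s. ennreal (indicator A s * f (st s)) \<partial>\<Omega>) = ennreal (measure \<Omega> A * (\<integral>x. f x \<partial>X))"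
    using f by (simp add: emeasure_eq_measure ennreal_mult integral_nonneg_AE ennreal_indicator mult.commute
        flip: ennreal_indicator)
  show ?thesis
    by (rule has_bochner_integral_nn_integral[OF _ _ _ *]) (use f in \<open>auto intro!: mult_nonneg_nonneg integral_nonneg_AE\<close>)
qed

text \<open>Only the states are conditioned; the noise keeps its law. This is the contribution of
  one pattern to the error probability.\<close>

lemma emeasure_conditioned_pair:
  assumes O: "prob_space \<Omega>" and Z: "prob_space Z" and A: "A \<in> sets \<Omega>" "emeasure \<Omega> A > 0"
    and st: "st \<in> measurable \<Omega> X" and mp: "measure_preserving st (uniform_measure \<Omega> A) X"
    and Y: "prob_space Y" and zm: "measure_preserving zm Z Y"
    and B: "B \<in> sets (X \<Otimes>\<^sub>M Y)"
  shows "{\<omega> \<in> space (\<Omega> \<Otimes>\<^sub>M Z). fst \<omega> \<in> A \<and> (st (fst \<omega>), zm (snd \<omega>)) \<in> B} \<in> sets (\<Omega> \<Otimes>\<^sub>M Z)"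
    and "measure (\<Omega> \<Otimes>\<^sub>M Z) {\<omega> \<in> space (\<Omega> \<Otimes>\<^sub>M Z). fst \<omega> \<in> A \<and> (st (fst \<omega>), zm (snd \<omega>)) \<in> B} =
      measure \<Omega> A * measure (X \<Otimes>\<^sub>M Y) B"
proof -
  interpret O: prob_space \<Omega> by fact
  interpret Z: prob_space Z by fact
  let ?U = "uniform_measure \<Omega> A"
  interpret U: prob_space ?U using A by (intro prob_space_uniform_measure) auto
  interpret OZ: pair_prob_space \<Omega> Z ..
  interpret UZ: pair_prob_space ?U Z ..
  have [measurable]: "zm \<in> measurable Z Y" "st \<in> measurable \<Omega> X" "A \<in> sets \<Omega>" "B \<in> sets (X \<Otimes>\<^sub>M Y)"
    using st A B zm by (auto simp: measure_preserving_def)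
  define C where "C = {\<omega> \<in> space (\<Omega> \<Otimes>\<^sub>M Z). (st (fst \<omega>), zm (snd \<omega>)) \<in> B}"
  define CA where "CA = {\<omega> \<in> space (\<Omega> \<Otimes>\<^sub>M Z). fst \<omega> \<in> A \<and> (st (fst \<omega>), zm (snd \<omega>)) \<in> B}"
  have Cm: "C \<in> sets (\<Omega> \<Otimes>\<^sub>M Z)" unfolding C_def by measurable
  show CAm: "{\<omega> \<in> space (\<Omega> \<Otimes>\<^sub>M Z). fst \<omega> \<in> A \<and> (st (fst \<omega>), zm (snd \<omega>)) \<in> B} \<in> sets (\<Omega> \<Otimes>\<^sub>M Z)" by measurable
  have sUZ: "sets (?U \<Otimes>\<^sub>M Z) = sets (\<Omega> \<Otimes>\<^sub>M Z)" by (intro sets_pair_measure_cong) auto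
  have "measure_preserving (\<lambda>\<omega>. (st (fst \<omega>), zm (snd \<omega>))) (?U \<Otimes>\<^sub>M Z) (X \<Otimes>\<^sub>M Y)"
    by (intro measure_preserving_pair mp zm Y)
  from measure_preserving_emeasure[OF this B]
  have "emeasure (X \<Otimes>\<^sub>M Y) B = emeasure (?U \<Otimes>\<^sub>M Z) C"
    by (simp add: C_def space_pair_measure)
  \<comment> \<open>Slicing at fixed noise leaves a set of states, whose conditional measure is a
    plain quotient.\<close>
  also have "\<dots> = (\<integral>\<^sup>+z. emeasure ?U ((\<lambda>s. (s, z)) -` C) \<partial>Z)"
    using Cm sUZ by (intro UZ.emeasure_pair_measure_alt2) auto
  finally have "emeasure \<Omega> A * emeasure (X \<Otimes>\<^sub>M Y) B = (\<integral>\<^sup>+z. emeasure \<Omega> A * emeasure ?U ((\<lambda>s. (s, z)) -` C) \<partial>Z)"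
    using UZ.measurable_emeasure_Pair2[of C] Cm sUZ by (simp add: nn_integral_cmult)
  also have "\<dots> = (\<integral>\<^sup>+z. emeasure \<Omega> ((\<lambda>s. (s, z)) -` CA) \<partial>Z)"
  proof (intro nn_integral_cong)
    fix z assume z: "z \<in> space Z"
    have "emeasure ?U ((\<lambda>s. (s, z)) -` C) = emeasure \<Omega> (A \<inter> (\<lambda>s. (s, z)) -` C) / emeasure \<Omega> A"
      using Cm by (intro emeasure_uniform_measure sets_Pair2) auto
    also have "A \<inter> (\<lambda>s. (s, z)) -` C = (\<lambda>s. (s, z)) -` CA"
      by (auto simp: C_def CA_def)
    finally show "emeasure \<Omega> A * emeasure ?U ((\<lambda>s. (s, z)) -` C) = emeasure \<Omega> ((\<lambda>s. (s, z)) -` CA)"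
      using mult_divide_cancel_ennreal[of "emeasure \<Omega> A"] A(2) by simp
  qed
  also have "\<dots> = emeasure (\<Omega> \<Otimes>\<^sub>M Z) CA"
    using CAm by (intro OZ.emeasure_pair_measure_alt2[symmetric]) (simp add: CA_def)
  finally show "measure (\<Omega> \<Otimes>\<^sub>M Z) {\<omega> \<in> space (\<Omega> \<Otimes>\<^sub>M Z). fst \<omega> \<in> A \<and> (st (fst \<omega>), zm (snd \<omega>)) \<in> B} =
      measure \<Omega> A * measure (X \<Otimes>\<^sub>M Y) B"
    by (simp add: measure_def CA_def flip: enn2real_mult)
qed

section \<open>Strength sequences with enough occurrences of every state\<close>

lemma count_deviation:
  assumes D: "prob_space D" and A: "A \<in> sets D" and n: "0 < n" and t: "0 \<le> t"
  defines "P \<equiv> PiM {..<n} (\<lambda>_. D)"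
  shows "{s \<in> space P. real (card {j \<in> {..<n}. s j \<in> A}) \<le> real n * measure D A - t} \<in> sets P"
    and "measure P {s \<in> space P. real (card {j \<in> {..<n}. s j \<in> A}) \<le> real n * measure D A - t} \<le> exp (- 2 * t\<^sup>2 / real n)"
proof -
  let ?P = "PiM {..<n} (\<lambda>_. D)"
  interpret P: prob_space ?P using D by (intro prob_space_PiM)
  interpret D: prob_space D by fact
  define X where "X = (\<lambda>(j::nat) s. indicator A (s j) :: real)"
  have comp: "measure_preserving (\<lambda>s. s j) ?P D" if "j < n" for j
    using that by (intro measure_preserving_component D) auto
  \<comment> \<open>Each indicator ranges over \<open>[0, 1]\<close>, so the squared ranges add up
    to \<open>n\<close>, the denominator in the exponent.\<close>
  interpret Hoeffding_ineq ?P "{..<n}" X "\<lambda>_. 0" "\<lambda>_. 1" "\<Sum>j<n. P.expectation (X j)"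
  proof unfold_locales
    show "P.indep_vars (\<lambda>_. borel) X {..<n}"
      unfolding X_def
      by (rule P.indep_vars_compose2[OF indep_vars_PiM_coordinates[OF D], where Y = "\<lambda>_. indicator A"])
         (use A in auto)
  qed (auto simp: X_def indicator_def)
  have "P.expectation (X j) = measure D A" if "j < n" for j
    unfolding X_def using measure_preserving_integral[OF comp[OF that], of "indicator A"] A by simp
  then have E: "(\<Sum>j<n. P.expectation (X j)) = real n * measure D A" by simp
  have C: "(\<Sum>j<n. X j s) = real (card {j \<in> {..<n}. s j \<in> A})" for s
    unfolding X_def indicator_def by (simp add: sum.If_cases Int_def)
  have [measurable]: "X j \<in> borel_measurable ?P" if "j \<in> {..<n}" for j
    using random_variable[OF that] .
  have "{s \<in> space ?P. (\<Sum>j<n. X j s) \<le> real n * measure D A - t} \<in> sets ?P" by measurable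
  then show "{s \<in> space P. real (card {j \<in> {..<n}. s j \<in> A}) \<le> real n * measure D A - t} \<in> sets P"
    unfolding C P_def .
  show "measure P {s \<in> space P. real (card {j \<in> {..<n}. s j \<in> A}) \<le> real n * measure D A - t} \<le> exp (- 2 * t\<^sup>2 / real n)"
    using Hoeffding_ineq_le[OF t] n unfolding E C P_def by simp
qed

text \<open>The \<open>i l\<close> need not be distinct, so counting occurrences of each value is not enough: the
  channel uses have to be assigned injectively.\<close>
definition good_patterns :: "(nat \<Rightarrow> 'v) \<Rightarrow> nat \<Rightarrow> nat \<Rightarrow> nat \<Rightarrow> (nat \<Rightarrow> 'v) set" where
  "good_patterns i L N N' = {v \<in> PiE {..<N'} (\<lambda>_. i ` {..<L}).
     \<exists>p. inj_on p ({..<N} \<times> {..<L}) \<and> p ` ({..<N} \<times> {..<L}) \<subseteq> {..<N'} \<and>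
       (\<forall>n<N. \<forall>l<L. v (p (n, l)) = i l)}"

text \<open>A value shared by \<open>m\<close> indices must provide \<open>N * m\<close> channel
  uses. Enough occurrences give an injection for each value; these glue to an injection because uses
  with different strengths are different.\<close>

lemma good_patternsI:
  assumes v: "v \<in> PiE {..<N'} (\<lambda>_. i ` {..<L})"
    and c: "\<And>x. x \<in> i ` {..<L} \<Longrightarrow> N * card {l \<in> {..<L}. i l = x} \<le> card {n \<in> {..<N'}. v n = x}"
  shows "v \<in> good_patterns i L N N'"
proof -
  have "\<exists>f. f ` ({..<N} \<times> {l \<in> {..<L}. i l = x}) \<subseteq> {n \<in> {..<N'}. v n = x} \<and>
      inj_on f ({..<N} \<times> {l \<in> {..<L}. i l = x})" if "x \<in> i ` {..<L}" for x
    using c[OF that] by (intro card_le_inj) (auto simp: card_cartesian_product)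
  then have "\<forall>x\<in>i ` {..<L}. \<exists>f. f ` ({..<N} \<times> {l \<in> {..<L}. i l = x}) \<subseteq> {n \<in> {..<N'}. v n = x} \<and>
      inj_on f ({..<N} \<times> {l \<in> {..<L}. i l = x})" by blast
  from bchoice[OF this] obtain f where f: "\<And>x. x \<in> i ` {..<L} \<Longrightarrow> f x ` ({..<N} \<times> {l \<in> {..<L}. i l = x}) \<subseteq> {n \<in> {..<N'}. v n = x}"
    "\<And>x. x \<in> i ` {..<L} \<Longrightarrow> inj_on (f x) ({..<N} \<times> {l \<in> {..<L}. i l = x})"
    by blast
  define p where "p = (\<lambda>(n, l). f (i l) (n, l))"
  have p: "p (n, l) < N'" "v (p (n, l)) = i l" if "n < N" "l < L" for n l
    using f(1)[of "i l"] that by (auto simp: p_def image_subset_iff)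
  have "inj_on p ({..<N} \<times> {..<L})"
  proof (rule inj_onI, clarsimp)
    fix n l n' l' assume *: "n < N" "l < L" "n' < N" "l' < L" "p (n, l) = p (n', l')"
    then have "i l = i l'" using p(2)[of n l] p(2)[of n' l'] by simp
    with * show "n = n' \<and> l = l'"
      using inj_onD[OF f(2)[of "i l"], of "(n, l)" "(n', l')"] by (auto simp: p_def)
  qed
  then show ?thesis
    unfolding good_patterns_def using v p by (intro CollectI conjI exI[of _ p]) auto
qed

text \<open>A value shared by \<open>m\<close> indices is expected \<open>N' * m / L\<close> times
  and needed \<open>N * m\<close> times, so the surplus is \<open>m * t\<close>, where
  \<open>t\<close> is the surplus of a single index. A bad pattern forces some count to fall short
  of its mean by at least \<open>t\<close>; Hoeffding bounds this for each of the at most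
  \<open>L\<close> values.\<close>

lemma bad_pattern_prob:
  fixes D :: "'v measure" and P :: "'p measure" and i :: "nat \<Rightarrow> 'v"
  assumes D: "prob_space D" and P: "prob_space P"
    and sing: "\<And>l. l < L \<Longrightarrow> {i l} \<in> sets D"
    and mult: "\<And>l. l < L \<Longrightarrow> measure D {i l} = real (card {l' \<in> {..<L}. i l' = i l}) / real L"
    and pos: "0 < L" "0 < N'" and N: "real N \<le> real N' / real L"
  defines "\<Omega> \<equiv> state_seq (D \<Otimes>\<^sub>M P) N'"
  shows "measure \<Omega> {s \<in> space \<Omega>. (\<lambda>n\<in>{..<N'}. fst (s n)) \<notin> good_patterns i L N N'} \<le>
     real L * exp (- 2 * (real N' / real L - real N)\<^sup>2 / real N')"
proof -
  interpret D: prob_space D by fact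
  interpret P: prob_space P by fact
  interpret DP: pair_prob_space D P ..
  interpret O: prob_space \<Omega> unfolding \<Omega>_def by (intro prob_space_state_seq DP.prob_space_axioms)
  let ?V = "i ` {..<L}"
  define t where "t = real N' / real L - real N"
  define A where "A = (\<lambda>x::'v. {x} \<times> space P)"
  define C where "C = (\<lambda>x. {s \<in> space \<Omega>. real (card {j \<in> {..<N'}. s j \<in> A x}) \<le> real N' * measure (D \<Otimes>\<^sub>M P) (A x) - t})"
  have t: "0 \<le> t" using N by (simp add: t_def)
  have Am: "A x \<in> sets (D \<Otimes>\<^sub>M P)" if "x \<in> ?V" for x
    using that sing by (auto simp: A_def)
  have mA: "measure (D \<Otimes>\<^sub>M P) (A x) = real (card {l \<in> {..<L}. i l = x}) / real L" if "x \<in> ?V" for x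
  proof -
    have "measure (D \<Otimes>\<^sub>M P) (A x) = measure D {x}"
      using that sing by (auto simp: A_def measure_def P.emeasure_pair_measure_Times P.emeasure_space_1)
    then show ?thesis using that mult by auto
  qed
  have Cm: "C x \<in> sets \<Omega>" if "x \<in> ?V" for x
    using count_deviation(1)[OF DP.prob_space_axioms Am[OF that] pos(2) t]
    unfolding C_def \<Omega>_def state_seq_def .
  have Cp: "measure \<Omega> (C x) \<le> exp (- 2 * t\<^sup>2 / real N')" if "x \<in> ?V" for x
    using count_deviation(2)[OF DP.prob_space_axioms Am[OF that] pos(2) t]
    unfolding C_def \<Omega>_def state_seq_def .
  \<comment> \<open>The multiplicities add up to \<open>L\<close>, so strengths outside the list
    have probability zero.\<close>
  have "DP.prob (\<Union>x\<in>?V. A x) = (\<Sum>x\<in>?V. DP.prob (A x))"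
    using Am by (intro DP.finite_measure_finite_Union) (auto simp: disjoint_family_on_def A_def)
  also have "\<dots> = (\<Sum>x\<in>?V. real (card {l \<in> {..<L}. i l = x})) / real L"
    by (simp add: mA sum_divide_distrib)
  also have "(\<Sum>x\<in>?V. real (card {l \<in> {..<L}. i l = x})) = real L"
    using sum.group[of "{..<L}" ?V i "\<lambda>_. 1::real"] by simp
  finally have "AE x in D \<Otimes>\<^sub>M P. x \<in> (\<Union>x\<in>?V. A x)"
    using pos by (intro DP.AE_prob_1) simp
  then have "AE s in \<Omega>. \<forall>n\<in>{..<N'}. s n \<in> (\<Union>x\<in>?V. A x)"
    unfolding \<Omega>_def state_seq_def
    by (intro AE_finite_allI finite_lessThan AE_PiM_component DP.prob_space_axioms)
  then have "AE s in \<Omega>. s \<in> {s \<in> space \<Omega>. (\<lambda>n\<in>{..<N'}. fst (s n)) \<notin> good_patterns i L N N'} \<longrightarrow> s \<in> (\<Union>x\<in>?V. C x)"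
  proof eventually_elim
    case (elim s)
    show ?case
    proof (intro impI, rule ccontr)
      assume s: "s \<in> {s \<in> space \<Omega>. (\<lambda>n\<in>{..<N'}. fst (s n)) \<notin> good_patterns i L N N'}"
        and nC: "s \<notin> (\<Union>x\<in>?V. C x)"
      have "(\<lambda>n\<in>{..<N'}. fst (s n)) \<in> good_patterns i L N N'"
      proof (rule good_patternsI)
        show "(\<lambda>n\<in>{..<N'}. fst (s n)) \<in> PiE {..<N'} (\<lambda>_. ?V)"
          using elim by (force simp: A_def)
        fix x assume x: "x \<in> ?V"
        define m where "m = card {l \<in> {..<L}. i l = x}"
        have m: "1 \<le> m"
          using x by (auto simp: m_def Suc_le_eq card_gt_0_iff)
        have "s \<notin> C x" using nC x by blast
        then have "real N' * (real m / real L) - t < real (card {j \<in> {..<N'}. s j \<in> A x})"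
          using s unfolding C_def mA[OF x] m_def by simp
        also have "{j \<in> {..<N'}. s j \<in> A x} = {n \<in> {..<N'}. (\<lambda>n\<in>{..<N'}. fst (s n)) n = x}"
          using elim by (force simp: A_def)
        finally have "real N' * (real m / real L) - t < real (card {n \<in> {..<N'}. (\<lambda>n\<in>{..<N'}. fst (s n)) n = x})" .
        moreover have "real N * real m \<le> real N' * (real m / real L) - t"
        proof -
          \<comment> \<open>Since \<open>m\<close> is at least 1, the deviation \<open>t\<close>,
            the same for all values, is within each surplus.\<close>
          have "0 \<le> (real m - 1) * t" using m t by simp
          then show ?thesis by (simp add: t_def algebra_simps diff_divide_distrib)
        qed
        ultimately have "real (N * m) \<le> real (card {n \<in> {..<N'}. (\<lambda>n\<in>{..<N'}. fst (s n)) n = x})"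
          by simp
        then show "N * card {l \<in> {..<L}. i l = x} \<le> card {n \<in> {..<N'}. (\<lambda>n\<in>{..<N'}. fst (s n)) n = x}"
          unfolding m_def of_nat_le_iff .
      qed
      with s show False by simp
    qed
  qed
  then have "measure \<Omega> {s \<in> space \<Omega>. (\<lambda>n\<in>{..<N'}. fst (s n)) \<notin> good_patterns i L N N'} \<le> measure \<Omega> (\<Union>x\<in>?V. C x)"
    using Cm by (intro O.finite_measure_mono_AE) auto
  also have "\<dots> \<le> (\<Sum>x\<in>?V. measure \<Omega> (C x))"
    using Cm by (intro measure_UNION_le) auto
  also have "\<dots> \<le> (\<Sum>x\<in>?V. exp (- 2 * t\<^sup>2 / real N'))"
    by (intro sum_mono Cp)
  also have "\<dots> \<le> real L * exp (- 2 * t\<^sup>2 / real N')"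
    using card_image_le[of "{..<L}" i] by simp
  finally show ?thesis by (simp add: t_def)
qed

text \<open>On a good pattern \<open>v\<close> the channel uses \<open>p v (n, l)\<close> replay the
  parallel code and all others are silent; on a bad pattern an error is conceded. Given the pattern,
  the selected phases and noises have exactly the law of \<open>N\<close> parallel uses, so the
  conditional error is that of the given code. A block spends at most \<open>N * L\<close> units of
  power per user, which \<open>N'\<close> uses can afford.\<close>

lemma mixture_code:
  fixes D :: "'v measure" and P :: "'p measure" and i :: "nat \<Rightarrow> 'v"
  assumes D: "prob_space D" and P: "prob_space P"
    and sing: "\<And>l. l < L \<Longrightarrow> {i l} \<in> sets D" "\<And>l. l < L \<Longrightarrow> measure D {i l} > 0"
    and gain: "\<And>\<phi> l r t. \<phi> \<in> space (PiM {..<L} (\<lambda>_. P)) \<Longrightarrow> l < L \<Longrightarrow> r < K \<Longrightarrow> t < K \<Longrightarrow>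
       gain (i l, \<phi> l) 0 r t = pg \<phi> l r t"
    and code: "valid_code K L (PiM {..<L} (\<lambda>_. P)) N pg M enc dec"
    and K: "0 < K" and N': "0 < N'" "N * L \<le> N'"
  defines "\<Omega> \<equiv> state_seq (D \<Otimes>\<^sub>M P) N'"
  shows "\<exists>enc' dec'. valid_code K 1 (D \<Otimes>\<^sub>M P) N' gain M enc' dec' \<and>
     err_prob K 1 (D \<Otimes>\<^sub>M P) N' gain M enc' dec' \<le>
       measure \<Omega> {s \<in> space \<Omega>. (\<lambda>n\<in>{..<N'}. fst (s n)) \<notin> good_patterns i L N N'} +
       err_prob K L (PiM {..<L} (\<lambda>_. P)) N pg M enc dec"
proof -
  note One_nat_def[simp del]
  interpret D: prob_space D by fact
  interpret P: prob_space P by fact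
  interpret DP: pair_prob_space D P ..
  interpret O: prob_space \<Omega> unfolding \<Omega>_def by (intro prob_space_state_seq DP.prob_space_axioms)
  let ?X = "{..<N} \<times> {..<L}"
  let ?VS = "good_patterns i L N N'"
  let ?PL = "PiM {..<L} (\<lambda>_. P)"
  let ?J = "joint_space K L ?PL N" and ?J' = "joint_space K 1 (D \<Otimes>\<^sub>M P) N'"
  let ?T = "state_seq ?PL N"
  interpret J': prob_space ?J' by (intro prob_space_joint_space DP.prob_space_axioms)
  have finVS: "finite ?VS"
    unfolding good_patterns_def by (intro finite_subset[OF _ finite_PiE[of "{..<N'}" "\<lambda>_. i ` {..<L}"]]) auto
  have VSE: "v \<in> PiE {..<N'} (\<lambda>_. i ` {..<L})" if "v \<in> ?VS" for v
    using that by (auto simp: good_patterns_def)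
  have "\<forall>v\<in>?VS. \<exists>p. inj_on p ?X \<and> p ` ?X \<subseteq> {..<N'} \<and> (\<forall>n<N. \<forall>l<L. v (p (n, l)) = i l)"
    by (auto simp: good_patterns_def)
  from bchoice[OF this] obtain p where p: "\<And>v. v \<in> ?VS \<Longrightarrow> inj_on (p v) ?X" "\<And>v. v \<in> ?VS \<Longrightarrow> p v ` ?X \<subseteq> {..<N'}"
    "\<And>v n l. v \<in> ?VS \<Longrightarrow> n < N \<Longrightarrow> l < L \<Longrightarrow> v (p v (n, l)) = i l"
    by blast
  have pN: "p v (n, l) < N'" if "v \<in> ?VS" "n < N" "l < L" for v n l
    using p(2)[OF that(1)] that by (auto simp: image_subset_iff)
  define pat where "pat = (\<lambda>v. {s \<in> space \<Omega>. \<forall>n<N'. fst (s n) = v n})"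
  define st where "st = (\<lambda>v (s :: nat \<Rightarrow> 'v \<times> 'p). \<lambda>n\<in>{..<N}. \<lambda>l\<in>{..<L}. snd (s (p v (n, l))))"
  \<comment> \<open>The index \<open>0\<close> is the only subchannel of the mixture
    network.\<close>
  define zm where "zm = (\<lambda>v (z :: nat \<times> nat \<times> nat \<Rightarrow> complex).
      \<lambda>j\<in>{..<N} \<times> {..<L} \<times> {..<K}. z (p v (fst j, fst (snd j)), 0, snd (snd j)))"
  define H where "H = (\<lambda>v k m n' x. if n' \<in> p v ` ?X
      then enc k m x (fst (inv_into ?X (p v) n')) (snd (inv_into ?X (p v) n')) else 0)"
  \<comment> \<open>A state sequence has only one pattern, so at most one term is nonzero; as a
    finite sum over patterns the encoder is visibly measurable.\<close>
  define enc' where "enc' = (\<lambda>k m s n' (l' :: nat). \<Sum>v\<in>?VS. indicator (pat v) s * H v k m n' (st v s))"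
  \<comment> \<open>On a bad pattern the answer \<open>M r\<close> is never a message, so such
    sequences lie entirely inside the error event.\<close>
  define dec' where "dec' = (\<lambda>r (y :: nat \<Rightarrow> nat \<Rightarrow> complex) s.
      let v = (\<lambda>n\<in>{..<N'}. fst (s n)) in
      if v \<in> ?VS then dec r (\<lambda>n l. if n < N \<and> l < L then y (p v (n, l)) 0 else 0) (st v s) else M r)"
  have pat_iff: "s \<in> pat v \<longleftrightarrow> (\<lambda>n\<in>{..<N'}. fst (s n)) = v" if "v \<in> ?VS" "s \<in> space \<Omega>" for v s
    using VSE[OF that(1)] that(2) unfolding pat_def
    by (auto simp: PiE_iff extensional_def fun_eq_iff)
  have pat_sum: "(\<Sum>v\<in>?VS. indicator (pat v) s * a v) = a u"
    if "u \<in> ?VS" "s \<in> pat u" for u s and a :: "(nat \<Rightarrow> 'v) \<Rightarrow> 'r::real_normed_field"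
  proof -
    have s: "s \<in> space \<Omega>" using that(2) by (simp add: pat_def)
    have "s \<notin> pat v" if "v \<in> ?VS - {u}" for v
      using pat_iff[of u s] pat_iff[of v s] that \<open>u \<in> ?VS\<close> \<open>s \<in> pat u\<close> s by auto
    then show ?thesis
      using finVS that by (subst sum.remove[of _ u]) auto
  qed
  have vD: "{v n} \<in> sets D" "measure D {v n} > 0" if "v \<in> ?VS" "n < N'" for v n
    using PiE_mem[OF VSE[OF that(1)], of n] that(2) sing by auto
  have patm: "pat v \<in> sets \<Omega>" if "v \<in> ?VS" for v
    using measure_preserving_conditioned_phases(1)[OF D P vD[OF that]] unfolding pat_def \<Omega>_def .
  have patpos: "emeasure \<Omega> (pat v) > 0" if "v \<in> ?VS" for v
    using measure_preserving_conditioned_phases(2)[OF D P vD[OF that]] unfolding pat_def \<Omega>_def .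
  have stm: "st v \<in> measurable \<Omega> ?T" if "v \<in> ?VS" for v
    unfolding st_def \<Omega>_def state_seq_def using pN[OF that]
    by (intro measurable_restrict measurable_compose[OF _ measurable_snd[of D P]]) auto
  have stmp: "measure_preserving (st v) (uniform_measure \<Omega> (pat v)) ?T" if "v \<in> ?VS" for v
    unfolding st_def pat_def \<Omega>_def
    by (intro measure_preserving_conditioned_select[OF D P vD[OF that] p(1,2)[OF that]])
  have zmp: "measure_preserving (zm v) (noise_seq K 1 N') (noise_seq K L N)" if "v \<in> ?VS" for v
    unfolding zm_def noise_seq_def
  proof (intro measure_preserving_reindex prob_space_cgauss)
    show "inj_on (\<lambda>j. (p v (fst j, fst (snd j)), 0::nat, snd (snd j))) ({..<N} \<times> {..<L} \<times> {..<K})"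
      using p(1)[OF that] by (auto simp: inj_on_def)
    show "(\<lambda>j. (p v (fst j, fst (snd j)), 0::nat, snd (snd j))) \<in> {..<N} \<times> {..<L} \<times> {..<K} \<rightarrow> {..<N'} \<times> {..<1} \<times> {..<K}"
      using pN[OF that] by auto
  qed
  define \<mu> where "\<mu> = (\<lambda>v. measure \<Omega> (pat v))"
  have \<mu>: "(\<Sum>v\<in>?VS. \<mu> v) \<le> 1" "\<And>v. 0 \<le> \<mu> v"
  proof -
    have "disjoint_family_on pat ?VS"
      using pat_iff unfolding disjoint_family_on_def pat_def by blast
    then have "(\<Sum>v\<in>?VS. \<mu> v) = measure \<Omega> (\<Union>v\<in>?VS. pat v)"
      unfolding \<mu>_def using patm finVS by (intro O.finite_measure_finite_Union[symmetric]) auto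
    then show "(\<Sum>v\<in>?VS. \<mu> v) \<le> 1" by simp
  qed (simp add: \<mu>_def)
  have H: "H v k m (p v (n, l)) x = enc k m x n l" if "v \<in> ?VS" "n < N" "l < L" for v k m n l x
    using inv_into_f_f[OF p(1)[OF that(1)], of "(n, l)"] that by (auto simp: H_def)
  have Hm: "(\<lambda>x. H v k m n' x) \<in> borel_measurable ?T" "integrable ?T (\<lambda>x. (cmod (H v k m n' x))\<^sup>2)"
    if "v \<in> ?VS" "k < K" "m < M k" for v k m n'
  proof -
    have "fst (inv_into ?X (p v) n') < N" "snd (inv_into ?X (p v) n') < L" if "n' \<in> p v ` ?X"
      using inv_into_into[OF that] by (auto simp: mem_Times_iff)
    then show "(\<lambda>x. H v k m n' x) \<in> borel_measurable ?T" "integrable ?T (\<lambda>x. (cmod (H v k m n' x))\<^sup>2)"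
      using code that unfolding H_def valid_code_def by (cases "n' \<in> p v ` ?X"; simp)+
  qed
  have encm: "(\<lambda>s. enc' k m s n' l') \<in> borel_measurable \<Omega>" if "k < K" "m < M k" for k m n' l'
    unfolding enc'_def
    using patm measurable_compose[OF stm Hm(1)[OF _ that]]
    by (intro borel_measurable_sum borel_measurable_times borel_measurable_indicator) auto
  have enc_sq: "(cmod (enc' k m s n' l'))\<^sup>2 = (\<Sum>v\<in>?VS. indicator (pat v) s * (cmod (H v k m n' (st v s)))\<^sup>2)" for k m s n' l'
  proof (cases "\<exists>u\<in>?VS. s \<in> pat u")
    case True
    then obtain u where u: "u \<in> ?VS" "s \<in> pat u" by blast
    show ?thesis unfolding enc'_def pat_sum[OF u] ..
  next
    case False
    then show ?thesis by (simp add: enc'_def)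
  qed
  have energy: "has_bochner_integral \<Omega> (\<lambda>s. (cmod (enc' k m s n' l'))\<^sup>2)
      (\<Sum>v\<in>?VS. \<mu> v * (\<integral>x. (cmod (H v k m n' x))\<^sup>2 \<partial>?T))" if "k < K" "m < M k" for k m n' l'
    unfolding enc_sq \<mu>_def using that
    by (intro has_bochner_integral_sum integral_conditioned[OF O.prob_space_axioms patm patpos stm stmp] Hm(2)) auto
  have out: "(\<lambda>n l. if n < N \<and> l < L then chan_out K 1 N' gain enc' r w s z (p v (n, l)) 0 else 0) =
      chan_out K L N pg enc r w (st v s) (zm v z)" if v: "v \<in> ?VS" "s \<in> pat v" and r: "r < K" for v r w s z
  proof (intro ext)
    fix n l
    have s: "s \<in> space \<Omega>" using v by (simp add: pat_def)
    show "(if n < N \<and> l < L then chan_out K 1 N' gain enc' r w s z (p v (n, l)) 0 else 0) =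
      chan_out K L N pg enc r w (st v s) (zm v z) n l"
    proof (cases "n < N \<and> l < L")
      case True
      then have nl: "n < N" "l < L" by auto
      have sp: "s (p v (n, l')) \<in> space D \<times> space P" if "l' < L" for l'
        using s pN[OF v(1) nl(1) that] unfolding \<Omega>_def state_seq_def space_PiM space_pair_measure by auto
      have "st v s n \<in> space ?PL"
        using sp nl by (auto simp: st_def space_PiM PiE_iff mem_Times_iff)
      moreover have "(i l, st v s n l) = s (p v (n, l))"
        using v nl pN[OF v(1) nl] p(3)[OF v(1) nl] by (auto simp: st_def pat_def prod_eq_iff)
      ultimately have g: "gain (s (p v (n, l))) 0 r t = pg (st v s n) l r t" if "t < K" for t
        using gain[of "st v s n" l r t] nl r that by simp
      have "enc' k m s (p v (n, l)) 0 = enc k m (st v s) n l" for k m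
        unfolding enc'_def pat_sum[OF v] by (rule H[OF v(1) nl])
      then show ?thesis
        using nl r g pN[OF v(1) nl] by (simp add: chan_out_def zm_def)
    next
      case False
      then show ?thesis by (auto simp: chan_out_def)
    qed
  qed
  let ?err = "err_event K L ?PL N pg enc dec" and ?err' = "err_event K 1 (D \<Otimes>\<^sub>M P) N' gain enc' dec'"
  define bad where "bad = {s \<in> space \<Omega>. (\<lambda>n\<in>{..<N'}. fst (s n)) \<notin> ?VS}"
  define E where "E = (\<lambda>v w. {\<omega> \<in> space ?J'. fst \<omega> \<in> pat v \<and> (st v (fst \<omega>), zm v (snd \<omega>)) \<in> ?err w})"
  have spJ': "space ?J' = space \<Omega> \<times> space (noise_seq K 1 N')"
    by (simp add: joint_space_def \<Omega>_def space_pair_measure)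
  have badm: "bad \<in> sets \<Omega>"
  proof -
    have "bad = space \<Omega> - (\<Union>v\<in>?VS. pat v)" using pat_iff by (auto simp: bad_def)
    then show ?thesis using patm finVS by auto
  qed
  \<comment> \<open>Again an exact description, needed for measurability. That bad patterns always
    give an error uses receiver 0, which exists as \<open>K\<close> is positive.\<close>
  have err': "?err' w = bad \<times> space (noise_seq K 1 N') \<union> (\<Union>v\<in>?VS. E v w)" if w: "w \<in> msgs K M" for w
  proof -
    have "\<omega> \<in> ?err' w \<longleftrightarrow> fst \<omega> \<in> bad \<or> (\<exists>v\<in>?VS. \<omega> \<in> E v w)" if \<omega>: "\<omega> \<in> space ?J'" for \<omega>
    proof (cases "(\<lambda>n\<in>{..<N'}. fst (fst \<omega> n)) \<in> ?VS")
      case False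
      have "fst \<omega> \<in> bad" using False \<omega> by (auto simp: bad_def spJ')
      moreover have "dec' 0 (chan_out K 1 N' gain enc' 0 w (fst \<omega>) (snd \<omega>)) (fst \<omega>) \<noteq> w 0"
        using False PiE_mem[OF w[unfolded msgs_def], of 0] K by (auto simp: dec'_def)
      ultimately show ?thesis using \<omega> K by (auto simp: err_event_def)
    next
      case True
      define v where "v = (\<lambda>n\<in>{..<N'}. fst (fst \<omega> n))"
      have v: "v \<in> ?VS" using True by (simp add: v_def)
      have s: "fst \<omega> \<in> space \<Omega>" and z: "snd \<omega> \<in> space (noise_seq K 1 N')" using \<omega> by (auto simp: spJ')
      have vp: "fst \<omega> \<in> pat v" using pat_iff[OF v s] by (simp add: v_def)
      have sp: "(st v (fst \<omega>), zm v (snd \<omega>)) \<in> space ?J"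
        using measurable_space[OF stm[OF v] s] measurable_space[OF measure_preserving_measurable[OF zmp[OF v]] z]
        by (simp add: joint_space_def space_pair_measure)
      have nb: "fst \<omega> \<notin> bad" using True by (simp add: bad_def)
      have "\<omega> \<in> E u w \<longleftrightarrow> u = v \<and> (st v (fst \<omega>), zm v (snd \<omega>)) \<in> ?err w" if "u \<in> ?VS" for u
        using pat_iff[OF that s] \<omega> vp by (auto simp: E_def v_def)
      then have "(\<exists>u\<in>?VS. \<omega> \<in> E u w) \<longleftrightarrow> (st v (fst \<omega>), zm v (snd \<omega>)) \<in> ?err w"
        using v by blast
      also have "\<dots> \<longleftrightarrow> (\<exists>r<K. dec r (chan_out K L N pg enc r w (st v (fst \<omega>)) (zm v (snd \<omega>))) (st v (fst \<omega>)) \<noteq> w r)"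
        using sp by (simp add: err_event_def)
      also have "\<dots> \<longleftrightarrow> (\<exists>r<K. dec' r (chan_out K 1 N' gain enc' r w (fst \<omega>) (snd \<omega>)) (fst \<omega>) \<noteq> w r)"
      proof -
        have "dec' r (chan_out K 1 N' gain enc' r w (fst \<omega>) (snd \<omega>)) (fst \<omega>) =
            dec r (chan_out K L N pg enc r w (st v (fst \<omega>)) (zm v (snd \<omega>))) (st v (fst \<omega>))" if "r < K" for r
          unfolding dec'_def Let_def v_def[symmetric] out[OF v vp that] using v by simp
        then show ?thesis by auto
      qed
      also have "\<dots> \<longleftrightarrow> \<omega> \<in> ?err' w" using \<omega> by (simp add: err_event_def)
      finally show ?thesis using nb by simp
    qed
    note mem = this
    have sub: "?err' w \<subseteq> space ?J'" "bad \<times> space (noise_seq K 1 N') \<subseteq> space ?J'" "\<And>v. E v w \<subseteq> space ?J'"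
      by (auto simp: err_event_def E_def spJ' bad_def)
    have "\<omega> \<in> ?err' w \<longleftrightarrow> \<omega> \<in> bad \<times> space (noise_seq K 1 N') \<union> (\<Union>v\<in>?VS. E v w)" for \<omega>
    proof (cases "\<omega> \<in> space ?J'")
      case True
      then have "snd \<omega> \<in> space (noise_seq K 1 N')" by (simp add: spJ' mem_Times_iff)
      then show ?thesis unfolding mem[OF True] by (simp add: mem_Times_iff)
    next
      case False
      then have "\<omega> \<notin> ?err' w" "\<omega> \<notin> bad \<times> space (noise_seq K 1 N')" "\<And>v. \<omega> \<notin> E v w"
        using sub by blast+
      then show ?thesis by blast
    qed
    then show ?thesis by blast
  qed
  have errm: "?err w \<in> sets (?T \<Otimes>\<^sub>M noise_seq K L N)" if "w \<in> msgs K M" for w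
    using code that by (auto simp: valid_code_def joint_space_def)
  have J': "?J' = \<Omega> \<Otimes>\<^sub>M noise_seq K 1 N'" by (simp add: joint_space_def \<Omega>_def)
  have Em: "E v w \<in> sets ?J'" if v: "v \<in> ?VS" and w: "w \<in> msgs K M" for v w
    unfolding E_def J'
    by (rule emeasure_conditioned_pair(1)[OF O.prob_space_axioms prob_space_noise_seq patm[OF v] patpos[OF v]
          stm[OF v] stmp[OF v] prob_space_noise_seq zmp[OF v] errm[OF w]])
  have Ep: "measure ?J' (E v w) = \<mu> v * measure ?J (?err w)" if v: "v \<in> ?VS" and w: "w \<in> msgs K M" for v w
    unfolding E_def J' \<mu>_def joint_space_def[of K L]
    by (rule emeasure_conditioned_pair(2)[OF O.prob_space_axioms prob_space_noise_seq patm[OF v] patpos[OF v]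
          stm[OF v] stmp[OF v] prob_space_noise_seq zmp[OF v] errm[OF w]])
  have badZm: "bad \<times> space (noise_seq K 1 N') \<in> sets ?J'" using badm by (auto simp: J')
  have "valid_code K 1 (D \<Otimes>\<^sub>M P) N' gain M enc' dec'"
    unfolding valid_code_def \<Omega>_def[symmetric]
  proof (intro conjI allI impI ballI)
    show "0 < M k" if "k < K" for k using code that by (auto simp: valid_code_def)
    show "?err' w \<in> sets ?J'" if "w \<in> msgs K M" for w
      unfolding err'[OF that] using Em that badZm finVS by (intro sets.Un sets.finite_UN) auto
    show "(\<lambda>s. enc' k m s n l) \<in> borel_measurable \<Omega>" if "k < K" "m < M k" for k m n l
      by (rule encm[OF that])
    show "integrable \<Omega> (\<lambda>s. (cmod (enc' k m s n l))\<^sup>2)" if "k < K" "m < M k" for k m n l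
      using energy[OF that] by (rule integrable.intros)
  next
    fix k l assume k: "k < K"
    define e where "e = (\<lambda>m n l. \<integral>x. (cmod (enc k m x n l))\<^sup>2 \<partial>?T)"
    have each: "(\<Sum>n'<N'. \<Sum>m<M k. \<integral>x. (cmod (H v k m n' x))\<^sup>2 \<partial>?T) \<le> real N' * real (M k)" if v: "v \<in> ?VS" for v
    proof -
      \<comment> \<open>Only the selected uses carry energy. They are in bijection with the pairs
        \<open>(n, l)\<close>, so the constraints of the \<open>L\<close> subchannels are
        added.\<close>
      have "(\<Sum>n'<N'. \<Sum>m<M k. \<integral>x. (cmod (H v k m n' x))\<^sup>2 \<partial>?T) =
          (\<Sum>n'\<in>p v ` ?X. \<Sum>m<M k. \<integral>x. (cmod (H v k m n' x))\<^sup>2 \<partial>?T)"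
        using p(2)[OF v] by (intro sum.mono_neutral_right) (auto simp: H_def)
      also have "\<dots> = (\<Sum>x\<in>?X. \<Sum>m<M k. e m (fst x) (snd x))"
        using H[OF v] by (subst sum.reindex[OF p(1)[OF v]]) (auto simp: e_def intro!: sum.cong)
      also have "\<dots> = (\<Sum>n<N. \<Sum>l<L. \<Sum>m<M k. e m n l)"
        by (subst sum.cartesian_product[of "\<lambda>n l. \<Sum>m<M k. e m n l"]) (simp add: split_def)
      also have "\<dots> = (\<Sum>l<L. \<Sum>n<N. \<Sum>m<M k. e m n l)"
        by (rule sum.swap)
      also have "\<dots> \<le> (\<Sum>l<L. real N * real (M k))"
        using code k by (intro sum_mono) (auto simp: valid_code_def e_def)
      also have "\<dots> = real (N * L) * real (M k)" by simp
      also have "\<dots> \<le> real N' * real (M k)"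
        using N'(2) by (intro mult_right_mono) (simp_all only: of_nat_le_iff of_nat_0_le_iff)
      finally show ?thesis .
    qed
    have "(\<Sum>n'<N'. \<Sum>m<M k. \<integral>s. (cmod (enc' k m s n' l))\<^sup>2 \<partial>\<Omega>) =
        (\<Sum>n'<N'. \<Sum>m<M k. \<Sum>v\<in>?VS. \<mu> v * (\<integral>x. (cmod (H v k m n' x))\<^sup>2 \<partial>?T))"
      using k by (intro sum.cong refl has_bochner_integral_integral_eq energy) auto
    also have "\<dots> = (\<Sum>v\<in>?VS. \<Sum>n'<N'. \<Sum>m<M k. \<mu> v * (\<integral>x. (cmod (H v k m n' x))\<^sup>2 \<partial>?T))"
      by (simp add: sum.swap[of _ ?VS])
    also have "\<dots> = (\<Sum>v\<in>?VS. \<mu> v * (\<Sum>n'<N'. \<Sum>m<M k. \<integral>x. (cmod (H v k m n' x))\<^sup>2 \<partial>?T))"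
      by (simp add: sum_distrib_left)
    also have "\<dots> \<le> (\<Sum>v\<in>?VS. \<mu> v * (real N' * real (M k)))"
      using each \<mu>(2) by (intro sum_mono mult_left_mono) auto
    also have "\<dots> \<le> 1 * (real N' * real (M k))"
      unfolding sum_distrib_right[symmetric] by (intro mult_right_mono \<mu>(1)) auto
    finally show "(\<Sum>n'<N'. \<Sum>m<M k. \<integral>s. (cmod (enc' k m s n' l))\<^sup>2 \<partial>\<Omega>) \<le> real N' * real (M k)" by simp
  qed (rule N')
  moreover have "err_prob K 1 (D \<Otimes>\<^sub>M P) N' gain M enc' dec' \<le> measure \<Omega> bad + err_prob K L ?PL N pg M enc dec"
  proof -
    have Wpos: "0 < card (msgs K M)"
      unfolding card_msgs using code by (intro prod_pos) (auto simp: valid_code_def)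
    interpret Z: prob_space "noise_seq K 1 N'" by (rule prob_space_noise_seq)
    have "measure ?J' (?err' w) \<le> measure \<Omega> bad + measure ?J (?err w)" if w: "w \<in> msgs K M" for w
    proof -
      have "measure ?J' (?err' w) \<le> measure ?J' (bad \<times> space (noise_seq K 1 N')) + measure ?J' (\<Union>v\<in>?VS. E v w)"
        unfolding err'[OF w] using badZm Em w finVS by (intro measure_Un_le sets.finite_UN) auto
      also have "measure ?J' (bad \<times> space (noise_seq K 1 N')) = measure \<Omega> bad"
        using badm by (simp add: J' measure_def Z.emeasure_pair_measure_Times Z.emeasure_space_1)
      also have "measure ?J' (\<Union>v\<in>?VS. E v w) \<le> (\<Sum>v\<in>?VS. measure ?J' (E v w))"
        using Em w finVS by (intro measure_UNION_le) auto
      also have "\<dots> = (\<Sum>v\<in>?VS. \<mu> v) * measure ?J (?err w)"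
        using Ep w by (simp add: sum_distrib_right)
      also have "\<dots> \<le> 1 * measure ?J (?err w)"
        by (intro mult_right_mono \<mu>(1)) auto
      finally show ?thesis by simp
    qed
    then have "(\<Sum>w\<in>msgs K M. measure ?J' (?err' w)) \<le> (\<Sum>w\<in>msgs K M. measure \<Omega> bad + measure ?J (?err w))"
      by (intro sum_mono)
    also have "\<dots> = real (card (msgs K M)) * measure \<Omega> bad + (\<Sum>w\<in>msgs K M. measure ?J (?err w))"
      by (simp add: sum.distrib)
    finally have "(\<Sum>w\<in>msgs K M. measure ?J' (?err' w)) / real (card (msgs K M)) \<le>
        (real (card (msgs K M)) * measure \<Omega> bad + (\<Sum>w\<in>msgs K M. measure ?J (?err w))) / real (card (msgs K M))"
      by (intro divide_right_mono) auto
    then show ?thesis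
      using Wpos by (auto simp: err_prob_def add_divide_distrib card_gt_0_iff)
  qed
  ultimately show ?thesis unfolding bad_def by blast
qed

text \<open>The factor \<open>1 / L\<close> reflects that a channel use of the mixture serves a
  single subchannel. The factor \<open>a < 1\<close> keeps the required number of occurrences a
  fixed fraction below its mean, which makes bad patterns exponentially unlikely.\<close>

lemma achievable_mixture:
  fixes D :: "'v measure" and P :: "'p measure" and i :: "nat \<Rightarrow> 'v"
  assumes D: "prob_space D" and P: "prob_space P"
    and sing: "\<And>l. l < L \<Longrightarrow> {i l} \<in> sets D"
    and mult: "\<And>l. l < L \<Longrightarrow> measure D {i l} = real (card {l' \<in> {..<L}. i l' = i l}) / real L"
    and gain: "\<And>\<phi> l r t. \<phi> \<in> space (PiM {..<L} (\<lambda>_. P)) \<Longrightarrow> l < L \<Longrightarrow> r < K \<Longrightarrow> t < K \<Longrightarrow>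
       gain (i l, \<phi> l) 0 r t = pg \<phi> l r t"
    and ach: "achievable K L (PiM {..<L} (\<lambda>_. P)) pg R"
    and K: "0 < K" and L: "0 < L" and a: "0 < a" "a < 1"
  shows "achievable K 1 (D \<Otimes>\<^sub>M P) gain (\<lambda>k. a * R k / real L)"
  unfolding achievable_def
proof (intro conjI allI impI)
  show "0 \<le> a * R k / real L" if "k < K" for k
    using ach a that by (auto simp: achievable_def)
next
  fix \<epsilon> :: real assume "\<epsilon> > 0"
  then have "\<epsilon> / 2 > 0" by simp
  then obtain N0 where N0: "\<And>N. N \<ge> N0 \<Longrightarrow> \<exists>M enc dec. valid_code K L (PiM {..<L} (\<lambda>_. P)) N pg M enc dec \<and>
        (\<forall>k<K. 2 powr (real N * R k) \<le> real (M k)) \<and>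
        err_prob K L (PiM {..<L} (\<lambda>_. P)) N pg M enc dec \<le> \<epsilon> / 2"
    using ach unfolding achievable_def by blast
  have pos: "measure D {i l} > 0" if "l < L" for l
  proof -
    have "0 < card {l' \<in> {..<L}. i l' = i l}" using that by (auto simp: card_gt_0_iff)
    then show ?thesis unfolding mult[OF that] using L by (intro divide_pos_pos) (simp_all only: of_nat_0_less_iff)
  qed
  \<comment> \<open>Half of the slack \<open>(1 - a) / L\<close> per channel use; the other half
    absorbs the rounding of \<open>N\<close> once \<open>c * N'\<close> is at least 1.\<close>
  define c where "c = (1 - a) / (2 * real L)"
  have c: "c > 0" using a L by (simp add: c_def)
  have "(\<lambda>n. real L * exp (- 2 * c\<^sup>2) ^ n) \<longlonglongrightarrow> real L * 0"
    using c by (intro tendsto_mult tendsto_const LIMSEQ_realpow_zero) auto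
  then have "eventually (\<lambda>n. real L * exp (- 2 * c\<^sup>2) ^ n < \<epsilon> / 2) sequentially"
    by (rule order_tendstoD(2)) (use \<open>\<epsilon> > 0\<close> in simp)
  then obtain N1 where N1: "\<And>n. n \<ge> N1 \<Longrightarrow> real L * exp (- 2 * c\<^sup>2) ^ n < \<epsilon> / 2"
    by (auto simp: eventually_sequentially)
  obtain N2 where N2: "real N0 * real L / a \<le> real N2" using real_arch_simple by blast
  obtain N3 where N3: "1 / c \<le> real N3" using real_arch_simple by blast
  show "\<exists>N0. \<forall>N\<ge>N0. \<exists>M enc dec. valid_code K 1 (D \<Otimes>\<^sub>M P) N gain M enc dec \<and>
        (\<forall>k<K. 2 powr (real N * (a * R k / real L)) \<le> real (M k)) \<and>
        err_prob K 1 (D \<Otimes>\<^sub>M P) N gain M enc dec \<le> \<epsilon>"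
  \<comment> \<open>\<open>N1\<close> makes bad patterns rarer than \<open>\<epsilon> / 2\<close>,
    \<open>N2\<close> ensures that \<open>N\<close> is at least \<open>N0\<close>, and
    \<open>N3\<close> ensures that \<open>c * N'\<close> is at least 1.\<close>
  proof (intro exI[of _ "1 + N1 + N2 + N3"] allI impI)
    fix N' assume N': "N' \<ge> 1 + N1 + N2 + N3"
    \<comment> \<open>Rounded up, so that the code for \<open>N\<close> parallel uses carries at
      least the required number of messages.\<close>
    define N where "N = nat \<lceil>a * real N' / real L\<rceil>"
    have Nge: "a * real N' / real L \<le> real N"
      unfolding N_def by (simp add: real_nat_ceiling_ge)
    have Nle: "real N \<le> a * real N' / real L + 1"
    proof -
      have "0 \<le> a * real N' / real L" using a by simp
      then have "0 \<le> \<lceil>a * real N' / real L\<rceil>" by (simp only: zero_le_ceiling)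
      then show ?thesis
        unfolding N_def using ceiling_correct[of "a * real N' / real L"] by simp
    qed
    have "real N0 \<le> a * real N' / real L"
    proof -
      have "real N0 * real L / a \<le> real N'" using N2 N' by simp
      then show ?thesis using a L by (simp add: field_simps)
    qed
    with Nge have "N \<ge> N0" by simp
    have "1 \<le> c * real N'"
    proof -
      have "1 / c \<le> real N'" using N3 N' by simp
      then show ?thesis using c by (simp add: field_simps)
    qed
    moreover have "real N' / real L - a * real N' / real L = 2 * c * real N'"
      using L by (simp add: c_def field_simps)
    ultimately have gap: "c * real N' \<le> real N' / real L - real N" using Nle by linarith
    have "0 \<le> c * real N'" using c by simp
    with gap have NL: "real N \<le> real N' / real L" by linarith
    then have "real (N * L) \<le> real N'" using L by (simp add: field_simps)
    then have NL': "N * L \<le> N'" by (simp only: of_nat_le_iff)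
    have N'pos: "0 < N'" using N' by simp
    obtain M enc dec where code: "valid_code K L (PiM {..<L} (\<lambda>_. P)) N pg M enc dec"
      "\<And>k. k < K \<Longrightarrow> 2 powr (real N * R k) \<le> real (M k)"
      "err_prob K L (PiM {..<L} (\<lambda>_. P)) N pg M enc dec \<le> \<epsilon> / 2"
      using N0[OF \<open>N \<ge> N0\<close>] by blast
    let ?\<Omega> = "state_seq (D \<Otimes>\<^sub>M P) N'"
    obtain enc' dec' where code': "valid_code K 1 (D \<Otimes>\<^sub>M P) N' gain M enc' dec'"
      "err_prob K 1 (D \<Otimes>\<^sub>M P) N' gain M enc' dec' \<le>
       measure ?\<Omega> {s \<in> space ?\<Omega>. (\<lambda>n\<in>{..<N'}. fst (s n)) \<notin> good_patterns i L N N'} +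
       err_prob K L (PiM {..<L} (\<lambda>_. P)) N pg M enc dec"
      using mixture_code[where gain = gain, OF D P sing pos gain code(1) K N'pos NL'] by blast
    have "measure ?\<Omega> {s \<in> space ?\<Omega>. (\<lambda>n\<in>{..<N'}. fst (s n)) \<notin> good_patterns i L N N'} \<le>
        real L * exp (- 2 * (real N' / real L - real N)\<^sup>2 / real N')"
      by (rule bad_pattern_prob[OF D P sing mult L N'pos NL])
    also have "\<dots> \<le> real L * exp (- 2 * c\<^sup>2 * real N')"
    proof -
      have "(c * real N')\<^sup>2 \<le> (real N' / real L - real N)\<^sup>2"
        using gap c by (intro power_mono) auto
      then have "c\<^sup>2 * real N' \<le> (real N' / real L - real N)\<^sup>2 / real N'"
        using N'pos by (simp add: field_simps power2_eq_square)
      then show ?thesis by (intro mult_left_mono) auto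
    qed
    also have "\<dots> = real L * exp (- 2 * c\<^sup>2) ^ N'"
      by (simp add: exp_of_nat_mult[symmetric] mult_ac)
    also have "\<dots> < \<epsilon> / 2" using N1[of N'] N' by simp
    finally have "err_prob K 1 (D \<Otimes>\<^sub>M P) N' gain M enc' dec' \<le> \<epsilon>"
      using code'(2) code(3) by linarith
    moreover have "2 powr (real N' * (a * R k / real L)) \<le> real (M k)" if "k < K" for k
    proof -
      have "0 \<le> R k" using ach that by (auto simp: achievable_def)
      then have "(a * real N' / real L) * R k \<le> real N * R k" by (intro mult_right_mono Nge)
      then have "2 powr (real N' * (a * R k / real L)) \<le> 2 powr (real N * R k)"
        by (intro powr_mono) (auto simp: mult_ac)
      also have "\<dots> \<le> real (M k)" by (rule code(2)[OF that])
      finally show ?thesis .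
    qed
    ultimately show "\<exists>M enc dec. valid_code K 1 (D \<Otimes>\<^sub>M P) N' gain M enc dec \<and>
        (\<forall>k<K. 2 powr (real N' * (a * R k / real L)) \<le> real (M k)) \<and>
        err_prob K 1 (D \<Otimes>\<^sub>M P) N' gain M enc dec \<le> \<epsilon>"
      using code'(1) by blast
  qed
qed

section \<open>Sum capacity as a supremum\<close>

lemma achievable_zero: "achievable K L S gain (\<lambda>_. 0)"
  unfolding achievable_def
proof (intro conjI allI impI)
  fix \<epsilon> :: real assume "\<epsilon> > 0"
  show "\<exists>N0. \<forall>N\<ge>N0. \<exists>M enc dec. valid_code K L S N gain M enc dec \<and>
        (\<forall>k<K. 2 powr (real N * 0) \<le> real (M k)) \<and> err_prob K L S N gain M enc dec \<le> \<epsilon>"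
  proof (intro exI[of _ 1] allI impI)
    fix N :: nat assume "1 \<le> N"
    let ?M = "\<lambda>_::nat. 1 :: nat" and ?enc = "\<lambda>_ _ _ _ _. 0" and ?dec = "\<lambda>_ _ _. 0"
    have err: "err_event K L S N gain ?enc ?dec w = {}" if "w \<in> msgs K ?M" for w
      using that by (auto simp: err_event_def msgs_def PiE_iff)
    then have "valid_code K L S N gain ?M ?enc ?dec"
      using \<open>1 \<le> N\<close> by (auto simp: valid_code_def)
    moreover have "err_prob K L S N gain ?M ?enc ?dec \<le> \<epsilon>"
      using err \<open>\<epsilon> > 0\<close> by (simp add: err_prob_def)
    ultimately show "\<exists>M enc dec. valid_code K L S N gain M enc dec \<and>
        (\<forall>k<K. 2 powr (real N * 0) \<le> real (M k)) \<and> err_prob K L S N gain M enc dec \<le> \<epsilon>"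
      by (intro exI[of _ ?M] exI[of _ ?enc] exI[of _ ?dec]) auto
  qed
qed auto

text \<open>The gain bound enters only through the crude converse, which makes the set of sum rates
  bounded above.\<close>

lemma sum_capacity_upper:
  assumes "prob_space S" "0 \<le> G" "AE s in S. \<forall>l<L. \<forall>r<K. \<forall>t<K. cmod (gain s l r t) \<le> G"
    and "achievable K L S gain R"
  shows "(\<Sum>k<K. R k) \<le> sum_capacity K L S gain"
  unfolding sum_capacity_def
proof (rule cSup_upper)
  show "bdd_above {(\<Sum>k<K. R k) | R. achievable K L S gain R}"
    using converse_bound[OF assms(1-3)] by (intro bdd_aboveI) blast
qed (use assms(4) in blast)

lemma sum_capacity_least:
  assumes "\<And>R. achievable K L S gain R \<Longrightarrow> (\<Sum>k<K. R k) \<le> c"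
  shows "sum_capacity K L S gain \<le> c"
  unfolding sum_capacity_def
  by (rule cSup_least) (use assms achievable_zero in blast)+

lemma sum_capacity_approx:
  assumes "\<epsilon> > 0"
  shows "\<exists>R. achievable K L S gain R \<and> sum_capacity K L S gain - \<epsilon> < (\<Sum>k<K. R k)"
proof -
  have "\<exists>x\<in>{(\<Sum>k<K. R k) | R. achievable K L S gain R}. Sup {(\<Sum>k<K. R k) | R. achievable K L S gain R} - \<epsilon> < x"
    using assms by (intro less_cSupD) (auto intro: achievable_zero)
  then show ?thesis by (auto simp: sum_capacity_def)
qed

section \<open>Phases and finitely supported strengths\<close>

lemma prob_space_phase_meas: "prob_space (phase_meas K)"
  unfolding phase_meas_def by (intro prob_space_PiM prob_space_uniform_measure) auto

lemma finite_offdiag: "finite (offdiag K)"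
  by (rule finite_subset[of _ "{..<K} \<times> {..<K}"]) (auto simp: offdiag_def)

text \<open>The image of a uniform index, not the uniform law on the set of values: states with
  equal strengths add up their weights. A singleton \<open>X\<close> gives a point mass, so a single
  state is covered as well.\<close>

definition strength_mixture :: "nat \<Rightarrow> nat set \<Rightarrow> (nat \<Rightarrow> nat \<times> nat \<Rightarrow> real) \<Rightarrow> (nat \<times> nat \<Rightarrow> real) measure" where
  "strength_mixture K X i = distr (measure_pmf (pmf_of_set X)) (PiM (offdiag K) (\<lambda>_. borel)) i"

context
  fixes K :: nat and X :: "nat set" and i :: "nat \<Rightarrow> nat \<times> nat \<Rightarrow> real"
  assumes X: "finite X" "X \<noteq> {}" and ext: "\<And>l. i l \<in> extensional (offdiag K)"
begin

lemma measurable_strength: "i \<in> measurable (measure_pmf (pmf_of_set X)) (PiM (offdiag K) (\<lambda>_. borel))"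
  using ext by (auto simp: space_PiM PiE_iff)

lemma prob_space_strength_mixture: "prob_space (strength_mixture K X i)"
  unfolding strength_mixture_def
  by (intro prob_space.prob_space_distr measurable_strength) (rule prob_space_measure_pmf)

lemma sets_strength_mixture: "sets (strength_mixture K X i) = sets (PiM (offdiag K) (\<lambda>_. borel))"
  by (simp add: strength_mixture_def)

lemma singleton_strength_mixture: "{i l} \<in> sets (strength_mixture K X i)"
proof -
  have "{i l} = PiE (offdiag K) (\<lambda>x. {i l x})"
    using ext[of l] by (auto simp: PiE_iff extensional_def fun_eq_iff) metis
  then show ?thesis
    using finite_offdiag unfolding sets_strength_mixture by (simp add: sets_PiM_I_finite)
qed

lemma measure_strength_mixture:
  "measure (strength_mixture K X i) {i l} = real (card {l' \<in> X. i l' = i l}) / real (card X)"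
proof -
  have "measure (strength_mixture K X i) {i l} = measure (measure_pmf (pmf_of_set X)) (i -` {i l})"
    using singleton_strength_mixture unfolding strength_mixture_def
    by (subst measure_distr[OF measurable_strength]) auto
  also have "\<dots> = real (card (X \<inter> i -` {i l})) / real (card X)"
    using X by (simp add: measure_pmf_of_set)
  also have "X \<inter> i -` {i l} = {l' \<in> X. i l' = i l}" by auto
  finally show ?thesis .
qed

lemma AE_strength_mixture: "AE x in strength_mixture K X i. x \<in> i ` X"
proof -
  have "i ` X \<in> sets (strength_mixture K X i)"
    using X singleton_strength_mixture by (subst UNION_singleton_eq_range[symmetric]) auto
  then have m: "{x \<in> space (PiM (offdiag K) (\<lambda>_. borel)). x \<in> i ` X} \<in> sets (PiM (offdiag K) (\<lambda>_. borel))"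
    using sets.sets_into_space by (force simp: sets_strength_mixture Collect_conj_eq)
  show ?thesis
    unfolding strength_mixture_def
    using X by (subst AE_distr_iff[OF measurable_strength m]) (auto simp: AE_measure_pmf_iff)
qed

lemma admissible_strength_mixture:
  assumes "B \<subseteq> offdiag K" "\<And>l p. l \<in> X \<Longrightarrow> p \<in> offdiag K \<Longrightarrow> 0 \<le> i l p"
    "\<And>l p. l \<in> X \<Longrightarrow> p \<in> B \<Longrightarrow> i l p = SNR"
  shows "admissible_INR K SNR B (strength_mixture K X i)"
  unfolding admissible_INR_def
proof (intro conjI prob_space_strength_mixture sets_strength_mixture)
  show "AE x in strength_mixture K X i. \<forall>p\<in>offdiag K. 0 \<le> x p"
    using AE_strength_mixture by eventually_elim (use assms in auto)
  show "AE x in strength_mixture K X i. \<forall>p\<in>B. x p = SNR"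
    using AE_strength_mixture by eventually_elim (use assms in auto)
qed

end

section \<open>Separability\<close>

text \<open>The sum of all strengths serves as gain bound; unlike a maximum it makes sense without
  any entries.\<close>

lemma entry_le_sum:
  fixes f :: "nat \<Rightarrow> nat \<Rightarrow> nat \<Rightarrow> real"
  assumes X: "finite X" and f: "\<And>l r t. l \<in> X \<Longrightarrow> r < K \<Longrightarrow> t < K \<Longrightarrow> 0 \<le> f l r t"
    and lrt: "l \<in> X" "r < K" "t < K"
  shows "f l r t \<le> (\<Sum>l\<in>X. \<Sum>r<K. \<Sum>t<K. f l r t)"
proof -
  have "f l r t \<le> (\<Sum>t<K. f l r t)" using lrt f by (intro member_le_sum) auto
  also have "\<dots> \<le> (\<Sum>r<K. \<Sum>t<K. f l r t)"
    using lrt f by (intro member_le_sum[of r _ "\<lambda>r. \<Sum>t<K. f l r t"] sum_nonneg) auto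
  also have "\<dots> \<le> (\<Sum>l\<in>X. \<Sum>r<K. \<Sum>t<K. f l r t)"
    using lrt f X by (intro member_le_sum[of l _ "\<lambda>l. \<Sum>r<K. \<Sum>t<K. f l r t"] sum_nonneg) auto
  finally show ?thesis .
qed

text \<open>The suprema need not be attained, so rates within \<open>\<epsilon>'\<close> of each
  capacity are combined.\<close>

lemma sum_fixed_le_parallel:
  assumes A: "\<forall>l<L. fixed_state K SNR (As l)"
  shows "(\<Sum>l<L. fixed_sum_capacity K (As l)) \<le> parallel_sum_capacity K L As"
proof (rule field_le_epsilon)
  fix \<epsilon> :: real assume "\<epsilon> > 0"
  let ?P = "phase_meas K"
  let ?g = "\<lambda>l \<phi> (l' :: nat) r t. complex_of_real (As l r t) * cis (\<phi> (r, t))"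
  let ?pg = "\<lambda>\<phi> l r t. complex_of_real (As l r t) * cis (\<phi> l (r, t))"
  define \<epsilon>' where "\<epsilon>' = \<epsilon> / (real L + 1)"
  have \<epsilon>': "\<epsilon>' > 0" using \<open>\<epsilon> > 0\<close> by (simp add: \<epsilon>'_def)
  have "\<forall>l. \<exists>R. achievable K 1 ?P (?g l) R \<and> sum_capacity K 1 ?P (?g l) - \<epsilon>' < (\<Sum>k<K. R k)"
    using sum_capacity_approx[OF \<epsilon>'] by blast
  from choice[OF this] obtain R where R: "\<And>l. achievable K 1 ?P (?g l) (R l)"
    "\<And>l. fixed_sum_capacity K (As l) - \<epsilon>' < (\<Sum>k<K. R l k)"
    unfolding fixed_sum_capacity_def by blast
  let ?PL = "PiM {..<L} (\<lambda>_. ?P)"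
  have PL: "prob_space ?PL" by (intro prob_space_PiM prob_space_phase_meas)
  have "achievable K L ?PL ?pg (\<lambda>k. \<Sum>l<L. R l k)"
    by (rule achievable_parallel[where h = "\<lambda>l \<phi>. \<phi> l" and T = "\<lambda>_. ?P" and g = ?g])
       (auto intro!: PL measure_preserving_component prob_space_phase_meas R simp del: One_nat_def)
  moreover define G where "G = (\<Sum>l<L. \<Sum>r<K. \<Sum>t<K. As l r t)"
  have As: "0 \<le> As l r t" if "l < L" "r < K" "t < K" for l r t
    using A that by (auto simp: fixed_state_def)
  have "0 \<le> G" unfolding G_def by (intro sum_nonneg As) auto
  moreover have "As l r t \<le> G" if "l < L" "r < K" "t < K" for l r t
    unfolding G_def using that As by (intro entry_le_sum) auto
  ultimately have "(\<Sum>k<K. \<Sum>l<L. R l k) \<le> parallel_sum_capacity K L As"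
    unfolding parallel_sum_capacity_def using As
    by (intro sum_capacity_upper[OF PL, of G]) (auto simp: norm_mult)
  moreover have "(\<Sum>l<L. fixed_sum_capacity K (As l)) \<le> (\<Sum>l<L. (\<Sum>k<K. R l k) + \<epsilon>')"
    using R(2) by (intro sum_mono) (smt (verit))
  moreover have "(\<Sum>l<L. (\<Sum>k<K. R l k) + \<epsilon>') = (\<Sum>k<K. \<Sum>l<L. R l k) + real L * \<epsilon>'"
    by (simp add: sum.distrib sum.swap[of _ "{..<L}"])
  moreover have "real L * \<epsilon>' \<le> \<epsilon>" using \<open>\<epsilon> > 0\<close> by (simp add: \<epsilon>'_def field_simps)
  ultimately show "(\<Sum>l<L. fixed_sum_capacity K (As l)) \<le> parallel_sum_capacity K L As + \<epsilon>"
    by linarith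
qed

text \<open>Squares, because the network gain takes the root of the INR; only cross-links, because
  the direct strengths come from \<open>SNR\<close>. The restriction makes it a point of the product
  space of strengths.\<close>

definition INR_of :: "nat \<Rightarrow> (nat \<Rightarrow> nat \<Rightarrow> real) \<Rightarrow> nat \<times> nat \<Rightarrow> real" where
  "INR_of K A = (\<lambda>p\<in>offdiag K. (A (fst p) (snd p))\<^sup>2)"

definition network_gain :: "real \<Rightarrow> (nat \<times> nat \<Rightarrow> real) \<times> (nat \<times> nat \<Rightarrow> real) \<Rightarrow> nat \<Rightarrow> nat \<Rightarrow> nat \<Rightarrow> complex" where
  "network_gain SNR = (\<lambda>(i, \<phi>) l r t. complex_of_real (if r = t then sqrt SNR else sqrt (i (r, t))) * cis (\<phi> (r, t)))"

lemma network_gain_INR_of: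
  assumes "fixed_state K SNR A" "r < K" "t < K"
  shows "network_gain SNR (INR_of K A, \<phi>) l r t = complex_of_real (A r t) * cis (\<phi> (r, t))"
  using assms by (auto simp: network_gain_def INR_of_def offdiag_def fixed_state_def)

text \<open>The product space contains arbitrarily large strengths, so the bound can hold only
  almost surely; it does, since almost every strength vector is one of finitely many.\<close>

lemma AE_network_gain_bounded:
  assumes X: "finite X" "X \<noteq> {}" and A: "\<And>l. l \<in> X \<Longrightarrow> fixed_state K SNR (As l)"
  defines "D \<equiv> strength_mixture K X (\<lambda>l. INR_of K (As l))"
  shows "AE s in D \<Otimes>\<^sub>M phase_meas K. \<forall>l<1. \<forall>r<K. \<forall>t<K.
    cmod (network_gain SNR s l r t) \<le> (\<Sum>l\<in>X. \<Sum>r<K. \<Sum>t<K. As l r t)"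
proof -
  have ext: "INR_of K (As l) \<in> extensional (offdiag K)" for l by (simp add: INR_of_def)
  let ?V = "(\<lambda>l. INR_of K (As l)) ` X"
  interpret D: prob_space D unfolding D_def by (intro prob_space_strength_mixture X ext)
  interpret P: prob_space "phase_meas K" by (rule prob_space_phase_meas)
  interpret DP: pair_prob_space D "phase_meas K" ..
  have Vm: "?V \<in> sets D"
    using X singleton_strength_mixture[OF X ext] unfolding D_def
    by (subst UNION_singleton_eq_range[symmetric]) auto
  have "AE x in D. x \<in> ?V" unfolding D_def by (rule AE_strength_mixture[OF X ext])
  then have "measure D ?V = 1" using D.prob_eq_1[OF Vm] by simp
  then have "DP.prob (?V \<times> space (phase_meas K)) = 1"
    using Vm by (simp add: measure_def P.emeasure_pair_measure_Times P.emeasure_space_1)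
  then have "AE s in D \<Otimes>\<^sub>M phase_meas K. s \<in> ?V \<times> space (phase_meas K)" by (rule DP.AE_prob_1)
  then show ?thesis
  proof eventually_elim
    case (elim s)
    then obtain l \<phi> where s: "l \<in> X" "s = (INR_of K (As l), \<phi>)" by auto
    have As: "0 \<le> As l r t" if "l \<in> X" "r < K" "t < K" for l r t
      using A that by (auto simp: fixed_state_def)
    have "cmod (network_gain SNR s l' r t) \<le> (\<Sum>l\<in>X. \<Sum>r<K. \<Sum>t<K. As l r t)" if rt: "r < K" "t < K" for l' r t
    proof -
      have "cmod (network_gain SNR s l' r t) = As l r t"
        unfolding s(2) network_gain_INR_of[OF A[OF s(1)] rt] using As[OF s(1) rt] by (simp add: norm_mult)
      also have "As l r t \<le> (\<Sum>l\<in>X. \<Sum>r<K. \<Sum>t<K. As l r t)"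
        using rt s As by (intro entry_le_sum X) auto
      finally show ?thesis .
    qed
    then show ?case by blast
  qed
qed

lemma network_sum_capacity_eq:
  "network_sum_capacity K SNR D = sum_capacity K 1 (D \<Otimes>\<^sub>M phase_meas K) (network_gain SNR)"
  by (simp add: network_sum_capacity_def network_gain_def)

text \<open>For every \<open>z < 1\<close>, the share \<open>z / L\<close> of any achievable
  parallel sum rate is achievable in the mixture; then \<open>z\<close> tends to 1.\<close>

lemma parallel_le_network_mixture:
  assumes K: "0 < K" and L: "0 < L" and A: "\<forall>l<L. fixed_state K SNR (As l)"
  shows "parallel_sum_capacity K L As \<le>
     real L * network_sum_capacity K SNR (strength_mixture K {..<L} (\<lambda>l. INR_of K (As l)))"
  unfolding parallel_sum_capacity_def
proof (rule sum_capacity_least)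
  let ?D = "strength_mixture K {..<L} (\<lambda>l. INR_of K (As l))" and ?P = "phase_meas K"
  fix R assume R: "achievable K L (PiM {..<L} (\<lambda>_. ?P)) (\<lambda>\<phi> l r t. complex_of_real (As l r t) * cis (\<phi> l (r, t))) R"
  have ext: "INR_of K (As l) \<in> extensional (offdiag K)" for l by (simp add: INR_of_def)
  have X: "finite {..<L}" "{..<L} \<noteq> {}" using L by auto
  have D: "prob_space ?D" by (intro prob_space_strength_mixture X ext)
  interpret DP: pair_prob_space ?D ?P
    using D prob_space_phase_meas
    by (simp add: pair_prob_space_def pair_sigma_finite_def prob_space_imp_sigma_finite)
  have "z * (\<Sum>k<K. R k) \<le> real L * network_sum_capacity K SNR ?D" if z: "0 < z" "z < 1" for z
  proof -
    have "achievable K 1 (?D \<Otimes>\<^sub>M ?P) (network_gain SNR) (\<lambda>k. z * R k / real L)"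
    proof (rule achievable_mixture[where i = "\<lambda>l. INR_of K (As l)"])
      show "measure ?D {INR_of K (As l)} = real (card {l' \<in> {..<L}. INR_of K (As l') = INR_of K (As l)}) / real L" for l
        using measure_strength_mixture[of "{..<L}" "\<lambda>l. INR_of K (As l)" K l] X ext by simp
      show "{INR_of K (As l)} \<in> sets ?D" for l
        by (rule singleton_strength_mixture[OF X ext])
      show "network_gain SNR (INR_of K (As l), \<phi> l) 0 r t = complex_of_real (As l r t) * cis (\<phi> l (r, t))"
        if "l < L" "r < K" "t < K" for \<phi> l r t
        using A that by (intro network_gain_INR_of) auto
    qed (use D prob_space_phase_meas R K L z in auto)
    then have "(\<Sum>k<K. z * R k / real L) \<le> network_sum_capacity K SNR ?D"
      unfolding network_sum_capacity_eq
      by (intro sum_capacity_upper[OF DP.prob_space_axioms _ AE_network_gain_bounded] sum_nonneg X)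
         (use A in \<open>auto simp: fixed_state_def\<close>)
    then show ?thesis
      using L by (simp add: sum_divide_distrib[symmetric] sum_distrib_left[symmetric] field_simps)
  qed
  then show "(\<Sum>k<K. R k) \<le> real L * network_sum_capacity K SNR ?D"
    by (rule field_le_mult_one_interval)
qed

text \<open>The network with constant strengths and the fixed-state channel differ only in their
  state spaces: pairing the phases with the constant strength vector identifies their laws, and
  codes are carried over along this map.\<close>

lemma network_le_fixed:
  assumes A: "fixed_state K SNR A"
  shows "network_sum_capacity K SNR (strength_mixture K {l} (\<lambda>_. INR_of K A)) \<le> fixed_sum_capacity K A"
  unfolding network_sum_capacity_eq
proof (rule sum_capacity_least)
  let ?D = "strength_mixture K {l} (\<lambda>_. INR_of K A)" and ?P = "phase_meas K"
  fix R assume R: "achievable K 1 (?D \<Otimes>\<^sub>M ?P) (network_gain SNR) R"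
  have X: "finite {l}" "{l} \<noteq> {}" by auto
  have ext: "(\<lambda>_::nat. INR_of K A) l \<in> extensional (offdiag K)" for l by (simp add: INR_of_def)
  interpret D: prob_space ?D by (intro prob_space_strength_mixture X ext)
  interpret P: prob_space ?P by (rule prob_space_phase_meas)
  have Dret: "emeasure ?D U = indicator U (INR_of K A)" if "U \<in> sets ?D" for U
  proof -
    have "emeasure ?D U = emeasure (measure_pmf (pmf_of_set {l})) ((\<lambda>_. INR_of K A) -` U)"
      using that measurable_strength[OF X ext] unfolding strength_mixture_def
      by (subst emeasure_distr) auto
    then show ?thesis by (auto simp: indicator_def vimage_def)
  qed
  let ?h = "\<lambda>\<phi>. (INR_of K A, \<phi>)"
  have "INR_of K A \<in> space ?D"
    using sets.sets_into_space[OF singleton_strength_mixture[OF X ext]] by auto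
  then have hm: "?h \<in> measurable ?P (?D \<Otimes>\<^sub>M ?P)" by measurable
  have "?D \<Otimes>\<^sub>M ?P = distr ?P (?D \<Otimes>\<^sub>M ?P) ?h"
  proof (rule pair_measure_eqI)
    fix U V assume U: "U \<in> sets ?D" and V: "V \<in> sets ?P"
    have "emeasure (distr ?P (?D \<Otimes>\<^sub>M ?P) ?h) (U \<times> V) = emeasure ?P (?h -` (U \<times> V) \<inter> space ?P)"
      using U V by (intro emeasure_distr hm) auto
    also have "?h -` (U \<times> V) \<inter> space ?P = (if INR_of K A \<in> U then V else {})"
      using sets.sets_into_space[OF V] by auto
    finally show "emeasure ?D U * emeasure ?P V = emeasure (distr ?P (?D \<Otimes>\<^sub>M ?P) ?h) (U \<times> V)"
      by (simp add: Dret[OF U] indicator_def)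
  qed (auto intro: D.sigma_finite_measure_axioms P.sigma_finite_measure_axioms)
  then have mp: "measure_preserving ?h ?P (?D \<Otimes>\<^sub>M ?P)"
    using hm by (simp add: measure_preserving_def)
  let ?g = "\<lambda>\<phi> (l :: nat) r t. complex_of_real (A r t) * cis (\<phi> (r, t))"
  \<comment> \<open>A single subchannel: the parallel construction acts here as transport along
    \<open>?h\<close>.\<close>
  have "achievable K 1 ?P ?g (\<lambda>k. \<Sum>l<(1::nat). R k)"
    by (rule achievable_parallel[where h = "\<lambda>_. ?h" and T = "\<lambda>_. ?D \<Otimes>\<^sub>M ?P" and g = "\<lambda>_. network_gain SNR"
          and R = "\<lambda>_. R"])
       (auto intro!: mp R P.prob_space_axioms simp: network_gain_INR_of[OF A] simp del: One_nat_def)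
  then have ach: "achievable K 1 ?P ?g R" by simp
  have nn: "0 \<le> A r t" if "r < K" "t < K" for r t using A that by (auto simp: fixed_state_def)
  have le: "A r t \<le> (\<Sum>r<K. \<Sum>t<K. A r t)" if "r < K" "t < K" for r t
    using entry_le_sum[of "{l}" K "\<lambda>_. A" l r t] nn that by simp
  show "(\<Sum>k<K. R k) \<le> fixed_sum_capacity K A"
    unfolding fixed_sum_capacity_def
    by (rule sum_capacity_upper[OF P.prob_space_axioms _ _ ach, of "\<Sum>r<K. \<Sum>t<K. A r t"])
       (auto intro!: sum_nonneg nn simp: norm_mult nn le)
qed

theorem theorem6:
  fixes K L :: nat and SNR :: real and B :: "(nat \<times> nat) set"
    and As :: "nat \<Rightarrow> nat \<Rightarrow> nat \<Rightarrow> real"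
  assumes "K \<ge> 2" and "SNR > 0"
    and "minimal_bottleneck_state K SNR B"
    and "\<forall>l<L. fixed_state K SNR (As l)"
    and "\<forall>l<L. \<forall>(r, t)\<in>B. As l r t = sqrt SNR"
  shows "separable K L As"
proof -
  obtain c where B: "B \<subseteq> offdiag K" and c: "\<And>D. admissible_INR K SNR B D \<Longrightarrow> network_sum_capacity K SNR D = c"
    using assms(3) by (auto simp: minimal_bottleneck_state_def bottleneck_state_def)
  have ext: "INR_of K A \<in> extensional (offdiag K)" for A by (simp add: INR_of_def)
  have INR: "INR_of K (As l) p = SNR" if "l < L" "p \<in> B" for l p
  proof -
    have "p \<in> offdiag K" using B that by blast
    then show ?thesis using assms(2,5) that by (auto simp: INR_of_def split_def)
  qed
  have INR0: "0 \<le> INR_of K A p" if "p \<in> offdiag K" for A p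
    using that by (simp add: INR_of_def)
  have "parallel_sum_capacity K L As \<le> (\<Sum>l<L. fixed_sum_capacity K (As l))"
  proof (cases "L = 0")
    case True
    \<comment> \<open>Without subchannels there are no states to mix; the crude converse is
      proportional to \<open>L\<close> and gives exactly zero.\<close>
    have "(\<Sum>k<K. R k) \<le> 0" if "achievable K 0 (PiM {..<0::nat} (\<lambda>_. phase_meas K))
        (\<lambda>\<phi> l r t. complex_of_real (As l r t) * cis (\<phi> l (r, t))) R" for R
      using converse_bound[OF prob_space_PiM[OF prob_space_phase_meas] _ _ that, of 0] by simp
    then show ?thesis
      using True by (auto simp: parallel_sum_capacity_def intro!: sum_capacity_least)
  next
    case False
    have "network_sum_capacity K SNR (strength_mixture K {..<L} (\<lambda>l. INR_of K (As l))) = c"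
      using False by (intro c admissible_strength_mixture ext B INR INR0) auto
    then have "parallel_sum_capacity K L As \<le> real L * c"
      using parallel_le_network_mixture[of K L SNR As] assms(1,4) False by simp
    also have "real L * c = (\<Sum>l<L. c)" by simp
    also have "\<dots> \<le> (\<Sum>l<L. fixed_sum_capacity K (As l))"
    proof (rule sum_mono)
      fix l assume l: "l \<in> {..<L}"
      \<comment> \<open>The point mass at one state meets the constraints of \<open>B\<close> too,
        so it has the same capacity \<open>c\<close> as the mixture.\<close>
      have "network_sum_capacity K SNR (strength_mixture K {l} (\<lambda>_. INR_of K (As l))) = c"
        using l by (intro c admissible_strength_mixture ext B INR INR0) auto
      then show "c \<le> fixed_sum_capacity K (As l)"
        using network_le_fixed[of K SNR "As l" l] assms(4) l by auto
    qed
    finally show ?thesis .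
  qed
  then show ?thesis
    unfolding separable_def using sum_fixed_le_parallel[OF assms(4)] by (rule antisym)
qed

end
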